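(* Let $H$ be a real separable Hilbert space, $\kappa\in(0,\infty)$, $A:=\kappa I$ on $H$, so that $-A$ generates the $C_0$-semigroup $S(t)=e^{-\kappa t}I$, $t\ge0$ (which is bounded analytic and consists of self-adjoint operators commuting with $Q$, and $A$ has a bounded inverse). Let $\gamma\in(\tfrac12,\infty)$ and suppose that $$\int_0^\infty\bigl\|t^{\gamma-1}S(t)Q^{\frac12}\bigr\|_{\mathscr L_2(H)}^2\,\mathrm dt<\infty.$$ Let $Z_\gamma=(Z_\gamma(t))_{t\in[0,\infty)}$ be the mild solution to $(\partial_t+A)^\gamma X(t)=\dot W^Q(t)$, $X(0)=0$, on $[0,\infty)$. Then the covariance function of $Z_\gamma$ is separable and its temporal part is asymptotically of Matérn type, i.e., there is a function $\varrho_{Z_\gamma}\colon[0,\infty)\times[0,\infty)\to\mathbb R$ such that $$\forall s,t\in[0,\infty):\quad Q_{Z_\gamma}(s,t)=\varrho_{Z_\gamma}(s,t)\,Q,$$ $$\forall h\in\mathbb R\setminus\{0\}:\quad\lim_{t\to\infty}\varrho_{Z_\gamma}(t,t+h)=\frac{2^{\frac12-\gamma}\kappa^{1-2\gamma}}{\sqrt\pi\,\Gamma(\gamma)}(\kappa|h|)^{\gamma-\frac12}K_{\gamma-\frac12}(\kappa|h|).$$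
   Context: $(\Omega,\mathcal F,\mathbb P)$ is a complete probability space with a normal filtration $(\mathcal F_t)_{t\ge0}$; $Q\in\mathscr L(H)$ is self-adjoint and strictly positive, i.e., there exists a constant $\theta\in(0,\infty)$ such that $(Qx,x)_H\ge\theta\|x\|_H^2$ for all $x\in H$; $(W^Q(t))_{t\ge0}$ is an $H$-valued cylindrical $Q$-Wiener process with respect to $(\mathcal F_t)_{t\ge0}$. $\mathscr L_2(H)$ denotes the Hilbert--Schmidt operators. $K_\nu$ denotes the modified Bessel function of the second kind. Mild solution on $[0,\infty)$: a predictable $H$-valued process $Z_\gamma$ such that for all $t\in[0,\infty)$, $Z_\gamma(t)=\frac1{\Gamma(\gamma)}\int_0^t(t-s)^{\gamma-1}S(t-s)\,\mathrm dW^Q(s)$, $\mathbb P$-a.s. The covariance operators $Q_{Z_\gamma}(s,t)\in\mathscr L(H)$ are defined by $(Q_{Z_\gamma}(s,t)x,y)_H=\mathbb E\bigl[(Z_\gamma(s)-\mathbb E[Z_\gamma(s)],x)_H(Z_\gamma(t)-\mathbb E[Z_\gamma(t)],y)_H\bigr]$ for all $x,y\in H$. *)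

theory Defs
  imports "HOL-Probability.Probability"
begin

section \<open>Operators on a real separable Hilbert space\<close>

text \<open>
  A real separable Hilbert space is a type of sort
  \<open>{real_inner, banach, second_countable_topology}\<close>.
\<close>

definition self_adjoint :: "('h::real_inner \<Rightarrow>\<^sub>L 'h) \<Rightarrow> bool" where
  "self_adjoint T \<longleftrightarrow> (\<forall>x y. inner (T x) y = inner x (T y))"

definition strictly_positive :: "('h::real_inner \<Rightarrow>\<^sub>L 'h) \<Rightarrow> bool" where
  "strictly_positive T \<longleftrightarrow> (\<exists>\<theta>>0. \<forall>x. inner (T x) x \<ge> \<theta> * (norm x)\<^sup>2)"

text \<open>\<open>T\<^sup>1\<^sup>/\<^sup>2\<close>: the unique nonnegative self-adjoint square root of a nonnegative self-adjoint \<open>T\<close>.\<close>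

definition op_sqrt :: "('h::real_inner \<Rightarrow>\<^sub>L 'h) \<Rightarrow> ('h \<Rightarrow>\<^sub>L 'h)" where
  "op_sqrt T = (THE R. self_adjoint R \<and> (\<forall>x. inner (R x) x \<ge> 0) \<and> R o\<^sub>L R = T)"

definition orthonormal_basis :: "'h::real_inner set \<Rightarrow> bool" where
  "orthonormal_basis B \<longleftrightarrow>
     (\<forall>e\<in>B. norm e = 1) \<and> pairwise orthogonal B \<and> closure (span B) = UNIV"

text \<open>
  The squared Hilbert--Schmidt norm; it is infinite iff \<open>T\<close> is not a Hilbert--Schmidt operator.
  The value does not depend on the orthonormal basis that is chosen.
\<close>

definition hs_norm_sq :: "('h::real_inner \<Rightarrow>\<^sub>L 'h) \<Rightarrow> ennreal" where
  "hs_norm_sq T =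
     (\<Sum>\<^sub>\<infinity>e\<in>(SOME B. orthonormal_basis B). ennreal ((norm (T e))\<^sup>2))"

definition C0_semigroup :: "(real \<Rightarrow> 'h::real_normed_vector \<Rightarrow>\<^sub>L 'h) \<Rightarrow> bool" where
  "C0_semigroup S \<longleftrightarrow>
     S 0 = id_blinfun \<and>
     (\<forall>s\<ge>0. \<forall>t\<ge>0. S (s + t) = S s o\<^sub>L S t) \<and>
     (\<forall>x. ((\<lambda>t. S t x) \<longlongrightarrow> x) (at_right 0))"

text \<open>
  \<open>S\<close> is a \<open>C\<^sub>0\<close>-semigroup whose infinitesimal generator is the operator \<open>G\<close>; only bounded,
  everywhere defined generators are needed.
\<close>

definition generates_C0_semigroup ::
    "('h::real_normed_vector \<Rightarrow>\<^sub>L 'h) \<Rightarrow> (real \<Rightarrow> 'h \<Rightarrow>\<^sub>L 'h) \<Rightarrow> bool" where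
  "generates_C0_semigroup G S \<longleftrightarrow>
     C0_semigroup S \<and> (\<forall>x. ((\<lambda>t. (S t x - x) /\<^sub>R t) \<longlongrightarrow> G x) (at_right 0))"

lemma generates_C0_semigroup_scaled_identity:
  "generates_C0_semigroup (- (\<kappa> *\<^sub>R id_blinfun))
     (\<lambda>t. exp (- \<kappa> * t) *\<^sub>R (id_blinfun :: 'h::real_normed_vector \<Rightarrow>\<^sub>L 'h))"
proof -
  have exp_lim: "((\<lambda>t::real. exp (- \<kappa> * t)) \<longlongrightarrow> 1) (at_right 0)"
    by (rule tendsto_eq_intros | simp)+
  have "((\<lambda>t::real. exp (- \<kappa> * t)) has_real_derivative - \<kappa>) (at 0)"
    by (auto intro!: derivative_eq_intros)
  then have "((\<lambda>t::real. (exp (- \<kappa> * t) - 1) / t) \<longlongrightarrow> - \<kappa>) (at 0)"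
    by (simp add: DERIV_def)
  then have quot_lim: "((\<lambda>t::real. (exp (- \<kappa> * t) - 1) / t) \<longlongrightarrow> - \<kappa>) (at_right 0)"
    by (rule filterlim_mono) (simp_all add: at_le)
  have "((\<lambda>t. (exp (- \<kappa> * t) *\<^sub>R x - x) /\<^sub>R t) \<longlongrightarrow> - \<kappa> *\<^sub>R x) (at_right 0)" for x :: 'h
    using tendsto_scaleR[OF quot_lim tendsto_const[of x]]
    by (simp add: divide_inverse algebra_simps)
  moreover have "((\<lambda>t. exp (- \<kappa> * t) *\<^sub>R x) \<longlongrightarrow> x) (at_right 0)" for x :: 'h
    using tendsto_scaleR[OF exp_lim tendsto_const[of x]] by simp
  ultimately show ?thesis
    unfolding generates_C0_semigroup_def C0_semigroup_def
    by (auto intro!: blinfun_eqI simp: blinfun.bilinear_simps distrib_left exp_add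
          simp flip: exp_add)
qed

section \<open>Filtrations, predictability and covariance operators\<close>

text \<open>Filtrations are indexed by \<open>t \<ge> 0\<close>; the values \<open>F t\<close> for \<open>t < 0\<close> are irrelevant.\<close>

definition normal_filtration :: "'a measure \<Rightarrow> (real \<Rightarrow> 'a measure) \<Rightarrow> bool" where
  "normal_filtration M F \<longleftrightarrow>
     (\<forall>t\<ge>0. subalgebra M (F t)) \<and>
     (\<forall>s\<ge>0. \<forall>t\<ge>s. sets (F s) \<subseteq> sets (F t)) \<and>
     null_sets M \<subseteq> sets (F 0) \<and>
     (\<forall>t\<ge>0. sets (F t) = (\<Inter>s\<in>{t<..}. sets (F s)))"

definition predictable_algebra :: "'a measure \<Rightarrow> (real \<Rightarrow> 'a measure) \<Rightarrow> (real \<times> 'a) measure" where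
  "predictable_algebra M F =
     sigma ({0..} \<times> space M)
       ({{s<..t} \<times> A |s t A. 0 \<le> s \<and> s < t \<and> A \<in> sets (F s)} \<union> {{0} \<times> A |A. A \<in> sets (F 0)})"

definition predictable_process ::
    "'a measure \<Rightarrow> (real \<Rightarrow> 'a measure) \<Rightarrow> (real \<Rightarrow> 'a \<Rightarrow> 'h::topological_space) \<Rightarrow> bool" where
  "predictable_process M F Z \<longleftrightarrow> (\<lambda>(t, \<omega>). Z t \<omega>) \<in> borel_measurable (predictable_algebra M F)"

definition cov_operator ::
    "'a measure \<Rightarrow> ('a \<Rightarrow> 'h) \<Rightarrow> ('a \<Rightarrow> 'h) \<Rightarrow>
      ('h::{real_inner, banach, second_countable_topology} \<Rightarrow>\<^sub>L 'h)" where
  "cov_operator M X Y =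
     (THE T :: 'h \<Rightarrow>\<^sub>L 'h. \<forall>x y. inner (T x) y =
        (\<integral>\<omega>. inner (X \<omega> - (\<integral>\<omega>'. X \<omega>' \<partial>M)) x * inner (Y \<omega> - (\<integral>\<omega>'. Y \<omega>' \<partial>M)) y \<partial>M))"

section \<open>Cylindrical Wiener processes and the stochastic integral\<close>

text \<open>The normal distribution with mean 0 and variance \<open>v \<ge> 0\<close>, degenerate if \<open>v = 0\<close>.\<close>

definition centered_gaussian :: "real \<Rightarrow> real measure" where
  "centered_gaussian v =
     (if v = 0 then return borel 0
      else density lborel (\<lambda>x. ennreal (normal_density 0 (sqrt v) x)))"

text \<open>
  Unless \<open>Q\<close> has finite trace, a cylindrical \<open>Q\<close>-Wiener process takes no values in \<open>H\<close> itself.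
  It is given by the real random variables \<open>W t x\<close>, which stand for \<open>(W\<^sup>Q(t), x)\<close>: they are
  linear in \<open>x\<close> and each \<open>W _ x\<close> is a Brownian motion with respect to the filtration with
  variance \<open>(Qx, x)\<close> per unit of time. Hence \<open>E[W s x * W t y] = min s t * (Qx, y)\<close>.
\<close>

definition cylindrical_Q_Wiener ::
    "'a measure \<Rightarrow> (real \<Rightarrow> 'a measure) \<Rightarrow> ('h::real_inner \<Rightarrow>\<^sub>L 'h) \<Rightarrow>
      (real \<Rightarrow> 'h \<Rightarrow> 'a \<Rightarrow> real) \<Rightarrow> bool" where
  "cylindrical_Q_Wiener M F Q W \<longleftrightarrow>
     (\<forall>t\<ge>0. \<forall>x. W t x \<in> borel_measurable (F t)) \<and>
     (\<forall>t\<ge>0. \<forall>x y. \<forall>a b::real.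
        AE \<omega> in M. W t (a *\<^sub>R x + b *\<^sub>R y) \<omega> = a * W t x \<omega> + b * W t y \<omega>) \<and>
     (\<forall>x. AE \<omega> in M. W 0 x \<omega> = 0) \<and>
     (\<forall>x. AE \<omega> in M. continuous_on {0..} (\<lambda>t. W t x \<omega>)) \<and>
     (\<forall>s\<ge>0. \<forall>t>s. \<forall>x.
        distr M borel (\<lambda>\<omega>. W t x \<omega> - W s x \<omega>) = centered_gaussian ((t - s) * inner (Q x) x) \<and>
        prob_space.indep_set M (sets (F s))
          {(\<lambda>\<omega>. W t x \<omega> - W s x \<omega>) -` B \<inter> space M |B. B \<in> sets borel})"

text \<open>
  A list of quadruples \<open>(a, b, x, y)\<close> encodes the step function
  \<open>s \<mapsto> \<Sum> 1\<^sub>(\<^sub>a\<^sub>,\<^sub>b\<^sub>](s) (_, x) y\<close> with values in the finite rank operators; its integral against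
  \<open>W\<^sup>Q\<close> is \<open>\<Sum> (W\<^sup>Q(b) - W\<^sup>Q(a), x) y\<close>.
\<close>

type_synonym 'h step = "(real \<times> real \<times> 'h \<times> 'h) list"

definition step_on :: "real \<Rightarrow> 'h step \<Rightarrow> bool" where
  "step_on T l \<longleftrightarrow> (\<forall>(a, b, x, y)\<in>set l. 0 \<le> a \<and> a \<le> b \<and> b \<le> T)"

definition step_fun :: "'h::real_inner step \<Rightarrow> real \<Rightarrow> 'h \<Rightarrow>\<^sub>L 'h" where
  "step_fun l s =
     (\<Sum>(a, b, x, y)\<leftarrow>l. indicator {a<..b} s *\<^sub>R (blinfun_scaleR_left y o\<^sub>L blinfun_inner_left x))"

definition step_integral ::
    "(real \<Rightarrow> 'h \<Rightarrow> 'a \<Rightarrow> real) \<Rightarrow> 'h::real_inner step \<Rightarrow> 'a \<Rightarrow> 'h" where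
  "step_integral W l \<omega> = (\<Sum>(a, b, x, y)\<leftarrow>l. (W b x \<omega> - W a x \<omega>) *\<^sub>R y)"

text \<open>
  \<open>Y = \<integral>\<^sub>0\<^sup>T \<Phi>(s) dW\<^sup>Q(s)\<close> almost surely, for a deterministic operator-valued integrand: the
  extension of the integral of step functions by the Ito isometry, i.e. by approximation of
  \<open>\<Phi> Q\<^sup>1\<^sup>/\<^sup>2\<close> in \<open>L\<^sup>2(0, T; \<L>\<^sub>2(H))\<close> and of \<open>Y\<close> in \<open>L\<^sup>2(\<Omega>; H)\<close>.
\<close>

definition has_stochastic_integral ::
    "'a measure \<Rightarrow> ('h \<Rightarrow>\<^sub>L 'h) \<Rightarrow> (real \<Rightarrow> 'h \<Rightarrow> 'a \<Rightarrow> real) \<Rightarrow> real \<Rightarrow>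
      (real \<Rightarrow> 'h::{real_inner, banach, second_countable_topology} \<Rightarrow>\<^sub>L 'h) \<Rightarrow> ('a \<Rightarrow> 'h) \<Rightarrow> bool"
  where
  "has_stochastic_integral M Q W T \<Phi> Y \<longleftrightarrow>
     (\<forall>x. set_borel_measurable lborel {0..T} (\<lambda>s. \<Phi> s x)) \<and>
     Y \<in> borel_measurable M \<and>
     (\<exists>l. (\<forall>n. step_on T (l n)) \<and>
        (\<lambda>n. \<integral>\<^sup>+s\<in>{0..T}. hs_norm_sq ((\<Phi> s - step_fun (l n) s) o\<^sub>L op_sqrt Q) \<partial>lborel)
          \<longlonglongrightarrow> 0 \<and>
        (\<lambda>n. \<integral>\<^sup>+\<omega>. ennreal ((norm (Y \<omega> - step_integral W (l n) \<omega>))\<^sup>2) \<partial>M) \<longlonglongrightarrow> 0)"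

text \<open>
  \<open>Z\<close> is a mild solution on \<open>[0, \<infinity>)\<close> to \<open>(\<partial>\<^sub>t + A)\<^sup>\<gamma> X = dW\<^sup>Q/dt\<close>, \<open>X(0) = 0\<close>, where \<open>-A\<close>
  generates the semigroup \<open>S\<close>.
\<close>

definition mild_solution ::
    "'a measure \<Rightarrow> (real \<Rightarrow> 'a measure) \<Rightarrow> ('h \<Rightarrow>\<^sub>L 'h) \<Rightarrow> (real \<Rightarrow> 'h \<Rightarrow> 'a \<Rightarrow> real) \<Rightarrow>
      ('h \<Rightarrow>\<^sub>L 'h) \<Rightarrow> (real \<Rightarrow> 'h::{real_inner, banach, second_countable_topology} \<Rightarrow>\<^sub>L 'h) \<Rightarrow>
      real \<Rightarrow> (real \<Rightarrow> 'a \<Rightarrow> 'h) \<Rightarrow> bool" where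
  "mild_solution M F Q W A S \<gamma> Z \<longleftrightarrow>
     generates_C0_semigroup (- A) S \<and>
     predictable_process M F Z \<and>
     (\<forall>t\<ge>0. \<exists>Y. has_stochastic_integral M Q W t (\<lambda>s. (t - s) powr (\<gamma> - 1) *\<^sub>R S (t - s)) Y \<and>
        (AE \<omega> in M. Z t \<omega> = (1 / Gamma \<gamma>) *\<^sub>R Y \<omega>))"

section \<open>The modified Bessel function of the second kind\<close>

text \<open>
  The standard definition (DLMF, Section 10.25(ii)) for real arguments \<open>x > 0\<close>: \<open>K\<^sub>\<nu>\<close> is the
  solution of the modified Bessel equation \<open>x\<^sup>2 w'' + x w' - (x\<^sup>2 + \<nu>\<^sup>2) w = 0\<close> with
  \<open>w(x) \<sim> sqrt (\<pi> / (2 x)) exp (-x)\<close> as \<open>x \<rightarrow> \<infinity>\<close>. It is unique on \<open>(0, \<infinity>)\<close>, since the other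
  solutions that are linearly independent of it grow exponentially.
\<close>

definition is_bessel_K :: "real \<Rightarrow> (real \<Rightarrow> real) \<Rightarrow> bool" where
  "is_bessel_K \<nu> w \<longleftrightarrow>
     (\<exists>w' w''. \<forall>x>0.
        (w has_real_derivative w' x) (at x) \<and> (w' has_real_derivative w'' x) (at x) \<and>
        x\<^sup>2 * w'' x + x * w' x - (x\<^sup>2 + \<nu>\<^sup>2) * w x = 0) \<and>
     w \<sim>[at_top] (\<lambda>x. sqrt (pi / (2 * x)) * exp (- x))"

definition bessel_K :: "real \<Rightarrow> real \<Rightarrow> real" where
  "bessel_K \<nu> x = (THE y. \<exists>w. is_bessel_K \<nu> w \<and> w x = y)"

end

theory Submission
  imports Defs
begin

text \<open>
  Since the semigroup acts by scalars, \<open>Z(t)\<close> is the stochastic integral over \<open>[0, t]\<close> of the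
  scalar kernel \<open>k\<^sub>t(r) = (t - r)\<^sup>\<gamma>\<^sup>-\<^sup>1 e\<^sup>-\<^sup>\<kappa>\<^sup>(\<^sup>t\<^sup>-\<^sup>r\<^sup>) / \<Gamma>(\<gamma>)\<close> times the identity. It has
  mean zero, and by the Ito isometry
  \<open>E[(Z(s), x) (Z(t), y)] = (\<integral> k\<^sub>s(r) k\<^sub>t(r) dr) (Qx, y)\<close>, so the covariance is
  \<open>\<rho>(s, t) Q\<close> with \<open>\<rho>(s, t) = \<integral> k\<^sub>s k\<^sub>t\<close>.

  The isometry is first proved for step functions, where it reduces to
  \<open>E[W s x * W t y] = min s t * (Qx, y)\<close> (\<open>step_Ito_isometry\<close>). Stochastic integrals are
  \<open>L\<^sup>2\<close>-limits of integrals of step functions, and both sides of the isometry pass to the limit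
  (\<open>stochastic_integral_covariance\<close>). On the side of the time integral this needs that the
  Hilbert--Schmidt norm of \<open>(\<Phi> - \<Phi>\<^sub>n) Q\<^sup>1\<^sup>/\<^sup>2\<close> controls the vectors \<open>Q\<^sup>1\<^sup>/\<^sup>2 (\<Phi> - \<Phi>\<^sub>n)\<^sup>* z\<close>, that
  \<open>Q\<^sup>1\<^sup>/\<^sup>2\<close> is a self-adjoint square root of \<open>Q\<close>, and that an orthonormal basis exists; the square
  root comes from a contraction argument (\<open>op_sqrt\<close>), the basis from the Gram--Schmidt process
  (\<open>orthonormal_basis_exists\<close>).

  For \<open>h > 0\<close> the substitution \<open>r = t - h p\<close> turns \<open>\<rho>(t, t + h)\<close> into
  \<open>h\<^sup>2\<^sup>\<gamma>\<^sup>-\<^sup>1 / \<Gamma>(\<gamma>)\<^sup>2\<close> times the integral of \<open>(p (p + 1))\<^sup>\<gamma>\<^sup>-\<^sup>1 e\<^sup>-\<^sup>\<kappa>\<^sup>h\<^sup>(\<^sup>2\<^sup>p\<^sup>+\<^sup>1\<^sup>)\<close> over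
  \<open>[0, t / h]\<close>, and the limit \<open>t \<rightarrow> \<infinity>\<close> exists by dominated convergence; negative \<open>h\<close> follow from
  the symmetry of \<open>\<rho>\<close>. The integral over \<open>[0, \<infinity>)\<close> is the classical representation of
  \<open>K\<^sub>\<gamma>\<^sub>-\<^sub>1\<^sub>/\<^sub>2(\<kappa>h)\<close>, up to an elementary factor. To identify it with the function that is defined by
  the modified Bessel equation and by the behaviour at infinity, the integral is shown to satisfy
  the equation (differentiation under the integral sign and integration by parts) and the
  asymptotic condition (\<open>is_bessel_K_bessel_K_formula\<close>), and these two conditions are shown to
  determine a solution uniquely by means of the Wronskian (\<open>is_bessel_K_unique\<close>).
\<close>

section \<open>The square root of a strictly positive operator\<close>

lemma self_adjointD: "self_adjoint T \<Longrightarrow> inner (blinfun_apply T x) y = inner x (T y)"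
  by (simp add: self_adjoint_def)

text \<open>
  Expanding \<open>|x - c Qx|\<^sup>2\<close> gives at most \<open>(1 - 2 c \<theta> + c\<^sup>2 |Q|\<^sup>2) |x|\<^sup>2\<close>, which is a proper
  contraction for small \<open>c\<close>. The rescaled operator \<open>c Q\<close> is thus within distance less than 1 of
  the identity, where a square root can be found by iteration.
\<close>
lemma scaled_contraction:
  fixes Q :: "'h::real_inner \<Rightarrow>\<^sub>L 'h"
  assumes "strictly_positive Q"
  obtains c where "c > 0" "norm (id_blinfun - c *\<^sub>R Q) < 1"
proof -
  obtain \<theta> where \<theta>: "\<theta> > 0" "\<And>x. inner (Q x) x \<ge> \<theta> * (norm x)\<^sup>2"
    using assms by (auto simp: strictly_positive_def)
  \<comment> \<open>adding \<open>\<theta>\<close> keeps \<open>N\<close> positive on the trivial space and ensures \<open>\<theta> \<le> N\<close>\<close>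
  define N where "N = norm Q + \<theta>"
  have N: "N > 0" "N \<ge> norm Q" "N \<ge> \<theta>" using \<theta>(1) norm_ge_zero[of Q] unfolding N_def by linarith+
  define c where "c = \<theta> / N\<^sup>2"
  have c: "c > 0" using \<theta> N by (simp add: c_def)
  define b where "b = 1 - c * \<theta>"
  have "\<theta>\<^sup>2 \<le> N\<^sup>2" using N \<theta> by (intro power_mono) auto
  then have "\<theta> * \<theta> / N\<^sup>2 \<le> 1" using N by (simp add: power2_eq_square divide_simps)
  then have b: "0 \<le> b" "b < 1" using mult_pos_pos[OF c \<theta>(1)] by (simp_all add: b_def c_def)
  have "norm ((id_blinfun - c *\<^sub>R Q) x) \<le> sqrt b * norm x" for x
  proof -
    have Qx: "norm (Q x) \<le> N * norm x"
      using norm_blinfun[of Q x] N(2) by (meson mult_right_mono norm_ge_zero order_trans)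
    have "(norm ((id_blinfun - c *\<^sub>R Q) x))\<^sup>2 = (norm x)\<^sup>2 - 2 * c * inner (Q x) x + c\<^sup>2 * (norm (Q x))\<^sup>2"
      unfolding power2_norm_eq_inner
      by (simp add: blinfun.bilinear_simps algebra_simps inner_commute power2_eq_square)
    also have "\<dots> \<le> (norm x)\<^sup>2 - 2 * c * (\<theta> * (norm x)\<^sup>2) + c\<^sup>2 * (N * norm x)\<^sup>2"
      using \<theta>(2)[of x] c power_mono[OF Qx norm_ge_zero, of 2]
      by (intro add_mono diff_mono mult_left_mono) auto
    also have "\<dots> = b * (norm x)\<^sup>2"
      using N by (simp add: b_def c_def field_simps power2_eq_square)
    finally show ?thesis
      using real_le_rsqrt by (fastforce simp: real_sqrt_mult)
  qed
  then have "norm (id_blinfun - c *\<^sub>R Q) \<le> sqrt b" using b by (intro norm_blinfun_bound) auto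
  also have "sqrt b < 1" using b by simp
  finally show ?thesis using c that by blast
qed

lemma closed_self_adjoint: "closed {T :: 'h::real_inner \<Rightarrow>\<^sub>L 'h. self_adjoint T}"
proof -
  have "{T :: 'h \<Rightarrow>\<^sub>L 'h. self_adjoint T} = (\<Inter>x. \<Inter>y. {T. inner (blinfun_apply T x) y = inner x (T y)})"
    by (auto simp: self_adjoint_def)
  also have "closed \<dots>" by (intro closed_INT ballI closed_Collect_eq continuous_intros)
  finally show ?thesis .
qed

lemma closed_commute: "closed {T :: 'h::real_inner \<Rightarrow>\<^sub>L 'h. C o\<^sub>L T = T o\<^sub>L C}"
  by (intro closed_Collect_eq continuous_intros)

text \<open>
  \<open>X = (B + X\<^sup>2) / 2\<close> says that \<open>(I - X)\<^sup>2 = I - B\<close>. The right-hand side is a contraction with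
  factor \<open>|B|\<close> on the ball of radius \<open>|B|\<close>. The closed conditions of being self-adjoint and of
  commuting with everything that commutes with \<open>B\<close> are preserved by it, so that the fixed point
  inherits them.
\<close>
lemma quadratic_fixed_point:
  fixes B :: "'h::{real_inner, banach} \<Rightarrow>\<^sub>L 'h"
  assumes B: "norm B < 1" "self_adjoint B"
  shows "\<exists>X. norm X \<le> norm B \<and> self_adjoint X \<and> X + X = B + (X o\<^sub>L X) \<and>
    (\<forall>C. C o\<^sub>L B = B o\<^sub>L C \<longrightarrow> C o\<^sub>L X = X o\<^sub>L C)"
proof -
  define S where "S = cball 0 (norm B) \<inter> {X. self_adjoint X} \<inter>
    (\<Inter>C\<in>{C. C o\<^sub>L B = B o\<^sub>L C}. {X. C o\<^sub>L X = X o\<^sub>L C})"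
  define f where "f X = (1/2) *\<^sub>R (B + (X o\<^sub>L X))" for X
  have "uniform_space_class.complete S" unfolding S_def complete_eq_closed
    by (intro closed_Int closed_INT ballI closed_self_adjoint closed_commute closed_cball)
  moreover have "B \<in> S" using B by (auto simp: S_def)
  then have "S \<noteq> {}" by blast
  moreover have "f ` S \<subseteq> S"
  proof
    fix Y assume "Y \<in> f ` S"
    then obtain X where X: "Y = f X" "X \<in> S" by blast
    then have X': "norm X \<le> norm B" "self_adjoint X" by (auto simp: S_def)
    have "norm (X o\<^sub>L X) \<le> norm B * 1"
      using X' B(1) by (intro order_trans[OF norm_blinfun_compose] mult_mono) auto
    then have "norm (B + (X o\<^sub>L X)) \<le> 2 * norm B" using norm_triangle_ineq[of B "X o\<^sub>L X"] by linarith
    then have "norm Y \<le> norm B" by (simp add: X f_def)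
    moreover have "self_adjoint Y"
      using X' B by (simp add: X f_def self_adjoint_def blinfun.bilinear_simps inner_add_left inner_add_right)
    moreover have "C o\<^sub>L Y = Y o\<^sub>L C" if C: "C o\<^sub>L B = B o\<^sub>L C" for C
    proof -
      have CX: "C o\<^sub>L X = X o\<^sub>L C" using X C by (auto simp: S_def)
      have "C (X x) = X (C x)" "C (B x) = B (C x)" for x
        using CX C by (metis blinfun_apply_blinfun_compose)+
      then show ?thesis by (intro blinfun_eqI) (simp add: X f_def blinfun.bilinear_simps)
    qed
    ultimately show "Y \<in> S" by (auto simp: S_def)
  qed
  moreover have "\<forall>X\<in>S. \<forall>Y\<in>S. dist (f X) (f Y) \<le> norm B * dist X Y"
  proof (intro ballI)
    fix X Y assume "X \<in> S" "Y \<in> S"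
    then have n: "norm X \<le> norm B" "norm Y \<le> norm B" by (auto simp: S_def)
    have "f X - f Y = (1/2) *\<^sub>R ((X o\<^sub>L (X - Y)) + ((X - Y) o\<^sub>L Y))"
      by (intro blinfun_eqI) (simp add: f_def blinfun.bilinear_simps algebra_simps)
    moreover have "norm ((X o\<^sub>L (X - Y)) + ((X - Y) o\<^sub>L Y)) \<le> norm X * norm (X - Y) + norm (X - Y) * norm Y"
      by (intro norm_triangle_le add_mono norm_blinfun_compose)
    moreover have "\<dots> \<le> norm B * norm (X - Y) + norm (X - Y) * norm B"
      using n by (intro add_mono mult_mono) auto
    ultimately show "dist (f X) (f Y) \<le> norm B * dist X Y" by (simp add: dist_norm)
  qed
  ultimately have "\<exists>!x. x \<in> S \<and> f x = x" using B by (intro Banach_fix) auto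
  then obtain X where X: "X \<in> S" "f X = X" by blast
  have "X + X = 2 *\<^sub>R f X" by (simp add: X(2) scaleR_2)
  also have "\<dots> = B + (X o\<^sub>L X)" by (simp add: f_def)
  finally have "X + X = B + (X o\<^sub>L X)" .
  moreover have "norm X \<le> norm B" "self_adjoint X" "\<And>C. C o\<^sub>L B = B o\<^sub>L C \<Longrightarrow> C o\<^sub>L X = X o\<^sub>L C"
    using X(1) unfolding S_def by simp_all
  ultimately show ?thesis by blast
qed

text \<open>
  With \<open>B = I - c Q\<close> and \<open>X\<close> as above, \<open>R = (I - X) / sqrt c\<close> is a square root, and it is strictly
  positive because \<open>|X| < 1\<close>. If \<open>R'\<close> is another nonnegative root, it commutes with \<open>Q = R'\<^sup>2\<close>, hence
  with \<open>R\<close>, so that \<open>(R + R') (R - R') = 0\<close>; strict positivity of \<open>R\<close> then forces \<open>R = R'\<close>.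
\<close>
lemma op_sqrt:
  fixes Q :: "'h::{real_inner, banach} \<Rightarrow>\<^sub>L 'h"
  assumes "self_adjoint Q" and "strictly_positive Q"
  shows "self_adjoint (op_sqrt Q)" and "op_sqrt Q o\<^sub>L op_sqrt Q = Q"
proof -
  obtain c where c: "c > 0" "norm (id_blinfun - c *\<^sub>R Q) < 1" by (rule scaled_contraction[OF assms(2)])
  define B where "B = id_blinfun - c *\<^sub>R Q"
  have nB: "norm B < 1" using c by (simp add: B_def)
  moreover have "self_adjoint B" using assms(1)
    by (simp add: B_def self_adjoint_def blinfun.bilinear_simps inner_diff_left inner_diff_right)
  ultimately obtain X where X: "norm X \<le> norm B" "self_adjoint X" "X + X = B + (X o\<^sub>L X)"
    and comm: "\<And>C. C o\<^sub>L B = B o\<^sub>L C \<Longrightarrow> C o\<^sub>L X = X o\<^sub>L C"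
    using quadratic_fixed_point by blast
  define R where "R = (1 / sqrt c) *\<^sub>R (id_blinfun - X)"
  have sa: "self_adjoint R" using X(2)
    by (simp add: R_def self_adjoint_def blinfun.bilinear_simps inner_diff_left inner_diff_right)
  have XX: "X x + X x = x - c *\<^sub>R Q x + X (X x)" for x
    using arg_cong[OF X(3), of "\<lambda>T. blinfun_apply T x"] by (simp add: B_def blinfun.bilinear_simps)
  have RR: "R o\<^sub>L R = Q"
  proof (rule blinfun_eqI)
    fix x
    have "(id_blinfun - X) ((id_blinfun - X) x) = c *\<^sub>R Q x"
      using XX[of x] by (simp add: blinfun.bilinear_simps algebra_simps)
    moreover have "(R o\<^sub>L R) x = (1 / sqrt c * (1 / sqrt c)) *\<^sub>R (id_blinfun - X) ((id_blinfun - X) x)"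
      by (simp only: R_def blinfun_apply_blinfun_compose scaleR_blinfun.rep_eq blinfun.scaleR_right scaleR_scaleR)
    ultimately show "(R o\<^sub>L R) x = Q x" using c by simp
  qed
  define \<delta> where "\<delta> = (1 - norm B) / sqrt c"
  have \<delta>: "\<delta> > 0" using c nB by (simp add: \<delta>_def)
  have low: "inner (R x) x \<ge> \<delta> * (norm x)\<^sup>2" for x
  proof -
    have "inner (X x) x \<le> norm (X x) * norm x" by (rule norm_cauchy_schwarz)
    also have "\<dots> \<le> (norm B * norm x) * norm x"
      using order_trans[OF norm_blinfun[of X x] mult_right_mono[OF X(1)]] by (intro mult_right_mono) auto
    finally have "(1 - norm B) * (norm x)\<^sup>2 \<le> inner (x - X x) x"
      by (simp add: inner_diff_left power2_norm_eq_inner[symmetric] algebra_simps power2_eq_square)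
    then show ?thesis using c
      by (simp add: R_def \<delta>_def blinfun.bilinear_simps divide_right_mono)
  qed
  have uniq: "R' = R" if R': "self_adjoint R'" "\<And>x. inner (R' x) x \<ge> 0" "R' o\<^sub>L R' = Q" for R'
  proof (rule blinfun_eqI)
    fix x
    have R'Q: "R' (R' x) = Q x" for x using fun_cong[OF arg_cong[OF R'(3), of blinfun_apply], of x] by simp
    have RQ: "R (R x) = Q x" for x using fun_cong[OF arg_cong[OF RR, of blinfun_apply], of x] by simp
    have "R' o\<^sub>L B = B o\<^sub>L R'"
      by (intro blinfun_eqI) (simp add: B_def blinfun.bilinear_simps R'Q[symmetric])
    from comm[OF this] have "R' (X x) = X (R' x)" for x
      by (simp only: blinfun_apply_blinfun_compose[symmetric])
    then have RR': "R' (R x) = R (R' x)" for x by (simp add: R_def blinfun.bilinear_simps)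
    define y where "y = R x - R' x"
    have "R y + R' y = 0" by (simp add: y_def blinfun.bilinear_simps RQ R'Q RR')
    then have "inner (R y) y + inner (R' y) y = 0" using inner_add_left[of "R y" "R' y" y] by simp
    then have "\<delta> * (norm y)\<^sup>2 \<le> 0" using low[of y] R'(2)[of y] by linarith
    then have "(norm y)\<^sup>2 \<le> 0" using \<delta> by (simp add: mult_le_0_iff)
    then show "R' x = R x" by (simp add: y_def)
  qed
  have pos: "inner (R x) x \<ge> 0" for x
    using low[of x] \<delta> by (meson order_trans less_imp_le mult_nonneg_nonneg zero_le_power2)
  have "op_sqrt Q = R" unfolding op_sqrt_def
  proof (rule the_equality)
    show "self_adjoint R \<and> (\<forall>x. 0 \<le> inner (R x) x) \<and> R o\<^sub>L R = Q" using sa pos RR by blast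
    fix R' assume "self_adjoint R' \<and> (\<forall>x. 0 \<le> inner (R' x) x) \<and> R' o\<^sub>L R' = Q"
    then show "R' = R" by (elim conjE, intro uniq) simp_all
  qed
  then show "self_adjoint (op_sqrt Q)" and "op_sqrt Q o\<^sub>L op_sqrt Q = Q" by (simp_all only: sa RR)
qed

section \<open>Orthonormal bases and the Hilbert--Schmidt norm\<close>

text \<open>One step of the Gram--Schmidt process.\<close>
lemma orthonormal_extend:
  fixes d :: "'h::real_inner"
  assumes B: "finite B" "\<forall>e\<in>B. norm e = 1" "pairwise orthogonal B"
  shows "\<exists>B'. (finite B' \<and> (\<forall>e\<in>B'. norm e = 1) \<and> pairwise orthogonal B') \<and> B \<subseteq> B' \<and> d \<in> span B'"
proof -
  define s where "s = (\<Sum>e\<in>B. inner d e *\<^sub>R e)"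
  define p where "p = d - s"
  have s: "s \<in> span B" unfolding s_def by (intro span_sum span_mul span_base)
  have orth: "inner p e = 0" if "e \<in> B" for e
  proof -
    have "(\<Sum>x\<in>B. inner d x * inner x e) = (\<Sum>x\<in>B. if x = e then inner d e else 0)"
      using B(2,3) that by (intro sum.cong) (auto simp: pairwise_def orthogonal_def norm_eq_1)
    then show ?thesis
      using B(1) that by (simp add: p_def s_def inner_diff_left inner_sum_left)
  qed
  show ?thesis
  proof (cases "p = 0")
    case True
    then show ?thesis using B s by (intro exI[of _ B]) (auto simp: p_def)
  next
    case False
    let ?B = "insert (p /\<^sub>R norm p) B"
    have "norm p *\<^sub>R (p /\<^sub>R norm p) + s \<in> span ?B"
    proof (rule span_add)
      show "norm p *\<^sub>R (p /\<^sub>R norm p) \<in> span ?B" by (rule span_mul, rule span_base) simp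
      show "s \<in> span ?B" using s span_mono[OF subset_insertI] by blast
    qed
    moreover have "norm p *\<^sub>R (p /\<^sub>R norm p) + s = d" using False by (simp add: p_def)
    ultimately have "d \<in> span ?B" by simp
    moreover have "pairwise orthogonal ?B"
      using B(3) orth by (auto simp: pairwise_insert orthogonal_def inner_commute)
    ultimately show ?thesis using B False by (intro exI[of _ ?B]) auto
  qed
qed

lemma orthonormal_basis_exists: "\<exists>B :: 'h::{real_inner, second_countable_topology} set. orthonormal_basis B"
proof -
  obtain D :: "'h set" where D: "countable D" "\<And>X. open X \<Longrightarrow> X \<noteq> {} \<Longrightarrow> \<exists>d\<in>D. d \<in> X"
    by (rule countable_dense_setE) blast
  have "D \<noteq> {}" using D(2)[of UNIV] by blast
  let ?P = "\<lambda>B :: 'h set. finite B \<and> (\<forall>e\<in>B. norm e = 1) \<and> pairwise orthogonal B"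
  have "\<exists>f. \<forall>n::nat. ?P (f n) \<and> (f n \<subseteq> f (Suc n) \<and> from_nat_into D n \<in> span (f (Suc n)))"
  proof (rule dependent_nat_choice)
    show "\<exists>B. ?P B" by (intro exI[of _ "{}"]) auto
    show "\<exists>B'. ?P B' \<and> B \<subseteq> B' \<and> from_nat_into D n \<in> span B'" if "?P B" for B n
      using orthonormal_extend[of B "from_nat_into D n"] that by blast
  qed
  then obtain f where f: "\<And>n::nat. ?P (f n)" "\<And>n. f n \<subseteq> f (Suc n)"
    "\<And>n. from_nat_into D n \<in> span (f (Suc n))" by blast
  have mono: "f m \<subseteq> f n" if "m \<le> n" for m n using f(2) that by (rule lift_Suc_mono_le)
  define B where "B = (\<Union>n. f n)"
  have D_span: "D \<subseteq> span B"
  proof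
    fix d assume "d \<in> D"
    then obtain n where "d = from_nat_into D n" using D(1) by (metis from_nat_into_surj)
    then show "d \<in> span B" using f(3)[of n] span_mono[of "f (Suc n)" B] by (auto simp: B_def)
  qed
  have "x \<in> closure (span B)" for x
    unfolding closure_approachable
  proof (intro allI impI)
    fix \<epsilon> :: real assume "\<epsilon> > 0"
    then obtain d where "d \<in> D" "d \<in> ball x \<epsilon>" using D(2)[of "ball x \<epsilon>"] by auto
    then show "\<exists>y\<in>span B. dist y x < \<epsilon>" using D_span by (auto simp: dist_commute)
  qed
  moreover have "pairwise orthogonal B"
  proof (rule pairwiseI)
    fix x y assume "x \<in> B" "y \<in> B" "x \<noteq> y"
    then obtain m n where "x \<in> f m" "y \<in> f n" by (auto simp: B_def)
    then have "x \<in> f (max m n)" "y \<in> f (max m n)" using mono by (meson max.cobounded1 max.cobounded2 subsetD)+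
    then show "orthogonal x y" using f(1) \<open>x \<noteq> y\<close> by (meson pairwiseD)
  qed
  moreover have "\<forall>e\<in>B. norm e = 1" using f(1) by (auto simp: B_def)
  ultimately show ?thesis by (auto simp: orthonormal_basis_def)
qed

text \<open>
  On the span of the basis this is the Cauchy--Schwarz inequality for the coordinates of \<open>x\<close>; it
  extends to the closure by continuity.
\<close>
lemma norm_le_hs_norm_sq:
  fixes T :: "'h::{real_inner, second_countable_topology} \<Rightarrow>\<^sub>L 'h"
  shows "ennreal ((norm (T x))\<^sup>2) \<le> ennreal ((norm x)\<^sup>2) * hs_norm_sq T"
proof (cases "hs_norm_sq T = \<top>")
  case True
  then show ?thesis
    by (cases "x = 0") (auto simp: ennreal_mult_top)
next
  case False
  then obtain c where c: "hs_norm_sq T = ennreal c" "c \<ge> 0" by (cases "hs_norm_sq T") auto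
  define B where "B = (SOME B :: 'h set. orthonormal_basis B)"
  have "orthonormal_basis B" unfolding B_def using orthonormal_basis_exists by (rule someI_ex)
  then have B: "\<And>e. e \<in> B \<Longrightarrow> norm e = 1" "pairwise orthogonal B" "closure (span B) = UNIV"
    by (auto simp: orthonormal_basis_def)
  have fin: "(\<Sum>e\<in>t. (norm (T e))\<^sup>2) \<le> c" if "finite t" "t \<subseteq> B" for t
  proof -
    have "(\<Sum>e\<in>t. ennreal ((norm (T e))\<^sup>2)) \<le> hs_norm_sq T"
      unfolding hs_norm_sq_def B_def[symmetric] infsum_finite[OF that(1), symmetric] using that
      by (intro infsum_mono_neutral nonneg_summable_on_complete) auto
    then show ?thesis using c by (simp add: sum_nonneg)
  qed
  have "span B \<subseteq> {x. norm (T x) \<le> sqrt c * norm x}"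
  proof
    fix x assume "x \<in> span B"
    then obtain t r where t: "finite t" "t \<subseteq> B" and x: "x = (\<Sum>e\<in>t. r e *\<^sub>R e)"
      by (auto simp: span_explicit)
    have "pairwise (\<lambda>i j. orthogonal (r i *\<^sub>R i) (r j *\<^sub>R j)) t"
      using B(2) t(2) by (auto simp: pairwise_def orthogonal_def)
    then have "(norm x)\<^sup>2 = (\<Sum>e\<in>t. (norm (r e *\<^sub>R e))\<^sup>2)"
      unfolding x by (intro norm_sum_Pythagorean t) (auto simp: pairwise_def)
    also have "\<dots> = (\<Sum>e\<in>t. (r e)\<^sup>2)"
      using B(1) t(2) by (intro sum.cong) auto
    finally have nx: "norm x = L2_set r t" by (simp add: L2_set_def real_sqrt_unique)
    have "norm (T x) \<le> (\<Sum>e\<in>t. norm (r e *\<^sub>R T e))"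
      unfolding x blinfun.sum_right blinfun.scaleR_right by (rule norm_sum)
    also have "\<dots> = (\<Sum>e\<in>t. \<bar>r e\<bar> * \<bar>norm (T e)\<bar>)" by simp
    also have "\<dots> \<le> L2_set r t * L2_set (\<lambda>e. norm (T e)) t" by (rule L2_set_mult_ineq)
    also have "\<dots> \<le> norm x * sqrt c"
      unfolding nx using fin[OF t] by (intro mult_left_mono) (auto simp: L2_set_def intro: sum_nonneg)
    finally show "x \<in> {x. norm (T x) \<le> sqrt c * norm x}" by (simp add: mult.commute)
  qed
  moreover have "closed {x. norm (T x) \<le> sqrt c * norm x}"
    by (intro closed_Collect_le continuous_intros)
  ultimately have "closure (span B) \<subseteq> {x. norm (T x) \<le> sqrt c * norm x}" by (rule closure_minimal)
  then have "norm (T x) \<le> sqrt c * norm x" using B(3) by auto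
  then have "(norm (T x))\<^sup>2 \<le> (sqrt c * norm x)\<^sup>2" by (intro power_mono) auto
  then show ?thesis using c by (simp add: ennreal_mult[symmetric] power_mult_distrib mult.commute)
qed

section \<open>Square integrable functions\<close>

definition square_integrable :: "'a measure \<Rightarrow> ('a \<Rightarrow> 'b::{real_inner, banach, second_countable_topology}) \<Rightarrow> bool" where
  "square_integrable M f \<longleftrightarrow> f \<in> borel_measurable M \<and> integrable M (\<lambda>x. (norm (f x))\<^sup>2)"

lemma square_integrable_measurable[measurable_dest]: "square_integrable M f \<Longrightarrow> f \<in> borel_measurable M"
  by (simp add: square_integrable_def)

lemma square_integrable_iff:
  "square_integrable M f \<longleftrightarrow> f \<in> borel_measurable M \<and> (\<integral>\<^sup>+x. ennreal ((norm (f x))\<^sup>2) \<partial>M) < \<infinity>"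
  unfolding square_integrable_def by (auto simp: integrable_iff_bounded)

lemma square_integrable_inner:
  assumes "square_integrable M f" "square_integrable M g"
  shows "integrable M (\<lambda>x. inner (f x) (g x))"
proof (rule Bochner_Integration.integrable_bound)
  show "integrable M (\<lambda>x. (norm (f x))\<^sup>2 + (norm (g x))\<^sup>2)"
    using assms by (auto simp: square_integrable_def)
  show "(\<lambda>x. inner (f x) (g x)) \<in> borel_measurable M"
    using assms by (intro borel_measurable_inner) (auto simp: square_integrable_def)
  have "\<bar>inner a b\<bar> \<le> (norm a)\<^sup>2 + (norm b)\<^sup>2" for a b :: 'b
  proof -
    have "\<bar>inner a b\<bar> \<le> norm a * norm b" by (rule Cauchy_Schwarz_ineq2)
    moreover have "2 * (norm a * norm b) \<le> (norm a)\<^sup>2 + (norm b)\<^sup>2"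
      using sum_squares_bound[of "norm a" "norm b"] by simp
    moreover have "norm a * norm b \<ge> 0" by simp
    ultimately show ?thesis by linarith
  qed
  then show "AE x in M. norm (inner (f x) (g x)) \<le> norm ((norm (f x))\<^sup>2 + (norm (g x))\<^sup>2)" by auto
qed

lemma square_integrable_add:
  assumes "square_integrable M f" "square_integrable M g"
  shows "square_integrable M (\<lambda>x. f x + g x)"
proof -
  have "(norm (f x + g x))\<^sup>2 = (norm (f x))\<^sup>2 + 2 * inner (f x) (g x) + (norm (g x))\<^sup>2" for x
    by (simp add: power2_norm_eq_inner inner_add_left inner_add_right inner_commute)
  then show ?thesis using assms square_integrable_inner[OF assms] by (auto simp: square_integrable_def)
qed

lemma square_integrable_scaleR:
  "square_integrable M f \<Longrightarrow> square_integrable M (\<lambda>x. c *\<^sub>R f x)"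
  by (auto simp: square_integrable_def power_mult_distrib)

lemma square_integrable_diff:
  "square_integrable M f \<Longrightarrow> square_integrable M g \<Longrightarrow> square_integrable M (\<lambda>x. f x - g x)"
  using square_integrable_add[of M f "\<lambda>x. (-1) *\<^sub>R g x"] square_integrable_scaleR[of M g "-1"] by simp

lemma integral_inner_Cauchy_Schwarz:
  assumes "square_integrable M f" "square_integrable M g"
  shows "\<bar>\<integral>x. inner (f x) (g x) \<partial>M\<bar> \<le> sqrt (\<integral>x. (norm (f x))\<^sup>2 \<partial>M) * sqrt (\<integral>x. (norm (g x))\<^sup>2 \<partial>M)"
proof -
  have [measurable]: "f \<in> borel_measurable M" "g \<in> borel_measurable M" using assms by (auto simp: square_integrable_def)
  have "ennreal \<bar>\<integral>x. inner (f x) (g x) \<partial>M\<bar> \<le> (\<integral>\<^sup>+x. ennreal (norm (inner (f x) (g x))) \<partial>M)"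
    using integral_norm_bound_ennreal[OF square_integrable_inner[OF assms]] by simp
  also have "\<dots> \<le> (\<integral>\<^sup>+x. ennreal (norm (f x)) * ennreal (norm (g x)) \<partial>M)"
    by (intro nn_integral_mono) (auto simp: ennreal_mult[symmetric] Cauchy_Schwarz_ineq2)
  finally have "(ennreal \<bar>\<integral>x. inner (f x) (g x) \<partial>M\<bar>)\<^sup>2 \<le> (\<integral>\<^sup>+x. ennreal (norm (f x)) * ennreal (norm (g x)) \<partial>M)\<^sup>2"
    by (intro power_mono) auto
  also have "\<dots> \<le> (\<integral>\<^sup>+x. (ennreal (norm (f x)))\<^sup>2 \<partial>M) * (\<integral>\<^sup>+x. (ennreal (norm (g x)))\<^sup>2 \<partial>M)"
    by (intro Cauchy_Schwarz_nn_integral) auto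
  also have "\<dots> = ennreal (\<integral>x. (norm (f x))\<^sup>2 \<partial>M) * ennreal (\<integral>x. (norm (g x))\<^sup>2 \<partial>M)"
    using assms by (simp add: ennreal_power square_integrable_def nn_integral_eq_integral)
  finally have "\<bar>\<integral>x. inner (f x) (g x) \<partial>M\<bar>\<^sup>2 \<le> (\<integral>x. (norm (f x))\<^sup>2 \<partial>M) * (\<integral>x. (norm (g x))\<^sup>2 \<partial>M)"
    by (simp add: ennreal_power ennreal_mult[symmetric])
  from real_sqrt_le_mono[OF this] show ?thesis by (simp add: real_sqrt_mult)
qed

text \<open>
  Some approximation error is finite, so the limit differs from a square integrable function by a
  square integrable one.
\<close>
lemma square_integrable_limit:
  assumes fn: "\<And>n. square_integrable M (fn n)" and f: "f \<in> borel_measurable M"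
    and lim: "(\<lambda>n. \<integral>\<^sup>+x. ennreal ((norm (f x - fn n x))\<^sup>2) \<partial>M) \<longlonglongrightarrow> 0"
  shows "square_integrable M f" "(\<lambda>n. \<integral>x. (norm (f x - fn n x))\<^sup>2 \<partial>M) \<longlonglongrightarrow> 0"
proof -
  have [measurable]: "f \<in> borel_measurable M" "\<And>n. fn n \<in> borel_measurable M"
    using f fn by (auto simp: square_integrable_def)
  have "\<forall>\<^sub>F n in sequentially. (\<integral>\<^sup>+x. ennreal ((norm (f x - fn n x))\<^sup>2) \<partial>M) < 1"
    using order_tendstoD(2)[OF lim, of 1] by simp
  then obtain n where n: "(\<integral>\<^sup>+x. ennreal ((norm (f x - fn n x))\<^sup>2) \<partial>M) < 1"
    by (auto simp: eventually_sequentially)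
  then have "(\<integral>\<^sup>+x. ennreal ((norm (f x - fn n x))\<^sup>2) \<partial>M) < \<infinity>"
    using order.strict_trans[OF _ ennreal_one_less_top] by (simp add: infinity_ennreal_def)
  then have "square_integrable M (\<lambda>x. f x - fn n x)" by (simp add: square_integrable_iff)
  from square_integrable_add[OF this fn[of n]] show f: "square_integrable M f" by simp
  have "square_integrable M (\<lambda>x. f x - fn n x)" for n using f fn by (rule square_integrable_diff)
  then have "(\<integral>\<^sup>+x. ennreal ((norm (f x - fn n x))\<^sup>2) \<partial>M) = ennreal (\<integral>x. (norm (f x - fn n x))\<^sup>2 \<partial>M)" for n
    by (intro nn_integral_eq_integral) (auto simp: square_integrable_def)
  then show "(\<lambda>n. \<integral>x. (norm (f x - fn n x))\<^sup>2 \<partial>M) \<longlonglongrightarrow> 0"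
    using lim by (simp add: ennreal_0[symmetric] del: ennreal_0)
qed

text \<open>Convergence in \<open>L\<^sup>2\<close> of both factors is enough to pass to the limit in the \<open>L\<^sup>2\<close> inner product.\<close>
lemma integral_inner_tendsto:
  assumes fn: "\<And>n. square_integrable M (fn n)" and f: "f \<in> borel_measurable M"
    and flim: "(\<lambda>n. \<integral>\<^sup>+x. ennreal ((norm (f x - fn n x))\<^sup>2) \<partial>M) \<longlonglongrightarrow> 0"
    and gn: "\<And>n. square_integrable M (gn n)" and g: "g \<in> borel_measurable M"
    and glim: "(\<lambda>n. \<integral>\<^sup>+x. ennreal ((norm (g x - gn n x))\<^sup>2) \<partial>M) \<longlonglongrightarrow> 0"
  shows "(\<lambda>n. \<integral>x. inner (fn n x) (gn n x) \<partial>M) \<longlonglongrightarrow> (\<integral>x. inner (f x) (g x) \<partial>M)"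
proof -
  note F = square_integrable_limit[OF fn f flim]
  note G = square_integrable_limit[OF gn g glim]
  define a where "a n = sqrt (\<integral>x. (norm (f x - fn n x))\<^sup>2 \<partial>M)" for n
  define b where "b n = sqrt (\<integral>x. (norm (g x - gn n x))\<^sup>2 \<partial>M)" for n
  define NF where "NF = sqrt (\<integral>x. (norm (f x))\<^sup>2 \<partial>M)"
  define NG where "NG = sqrt (\<integral>x. (norm (g x))\<^sup>2 \<partial>M)"
  have ab: "a \<longlonglongrightarrow> 0" "b \<longlonglongrightarrow> 0"
    using tendsto_real_sqrt[OF F(2)] tendsto_real_sqrt[OF G(2)] by (auto simp: a_def[abs_def] b_def[abs_def])
  have "\<bar>(\<integral>x. inner (fn n x) (gn n x) \<partial>M) - (\<integral>x. inner (f x) (g x) \<partial>M)\<bar> \<le> a n * b n + a n * NG + NF * b n" for n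
  proof -
    have df: "square_integrable M (\<lambda>x. f x - fn n x)" using F fn by (intro square_integrable_diff) auto
    have dg: "square_integrable M (\<lambda>x. g x - gn n x)" using G gn by (intro square_integrable_diff) auto
    note I = square_integrable_inner[OF df dg] square_integrable_inner[OF df G(1)]
      square_integrable_inner[OF F(1) dg] square_integrable_inner[OF F(1) G(1)]
    have "(\<integral>x. inner (fn n x) (gn n x) \<partial>M)
      = (\<integral>x. inner (f x - fn n x) (g x - gn n x) - inner (f x - fn n x) (g x)
          - inner (f x) (g x - gn n x) + inner (f x) (g x) \<partial>M)"
      by (intro Bochner_Integration.integral_cong) (auto simp: inner_diff_left inner_diff_right)
    also have "\<dots> = (\<integral>x. inner (f x - fn n x) (g x - gn n x) \<partial>M) - (\<integral>x. inner (f x - fn n x) (g x) \<partial>M)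
          - (\<integral>x. inner (f x) (g x - gn n x) \<partial>M) + (\<integral>x. inner (f x) (g x) \<partial>M)"
      using I by simp
    finally show ?thesis
      using integral_inner_Cauchy_Schwarz[OF df dg] integral_inner_Cauchy_Schwarz[OF df G(1)]
        integral_inner_Cauchy_Schwarz[OF F(1) dg]
      unfolding a_def b_def NF_def NG_def by linarith
  qed
  then have "\<forall>\<^sub>F n in sequentially. norm ((\<integral>x. inner (fn n x) (gn n x) \<partial>M) - (\<integral>x. inner (f x) (g x) \<partial>M))
      \<le> a n * b n + a n * NG + NF * b n"
    unfolding real_norm_def by (intro always_eventually allI)
  moreover have "(\<lambda>n. a n * b n + a n * NG + NF * b n) \<longlonglongrightarrow> 0 * 0 + 0 * NG + NF * 0"
    using ab by (intro tendsto_intros)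
  then have "(\<lambda>n. a n * b n + a n * NG + NF * b n) \<longlonglongrightarrow> 0" by simp
  ultimately have "(\<lambda>n. (\<integral>x. inner (fn n x) (gn n x) \<partial>M) - (\<integral>x. inner (f x) (g x) \<partial>M)) \<longlonglongrightarrow> 0"
    by (rule Lim_null_comparison)
  then show ?thesis by (rule LIM_zero_cancel)
qed

section \<open>Covariances of a cylindrical Wiener process\<close>

lemma return_moments:
  "integrable (return borel (0::real)) (\<lambda>x. x)" "(\<integral>x. x \<partial>return borel (0::real)) = 0"
  "integrable (return borel (0::real)) (\<lambda>x. x\<^sup>2)" "(\<integral>x. x\<^sup>2 \<partial>return borel (0::real)) = 0"
proof -
  have int: "integrable (return borel (0::real)) f" and val: "(\<integral>x. f x \<partial>return borel (0::real)) = f 0"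
    if "f \<in> borel_measurable borel" for f :: "real \<Rightarrow> real"
    using that by (auto simp: integrable_iff_bounded nn_integral_return intro: integral_return)
  show "integrable (return borel (0::real)) (\<lambda>x. x)" by (rule int) simp
  show "(\<integral>x. x \<partial>return borel (0::real)) = 0" by (rule val[of "\<lambda>x. x"]) simp
  show "integrable (return borel (0::real)) (\<lambda>x. x\<^sup>2)" by (rule int) simp
  show "(\<integral>x. x\<^sup>2 \<partial>return borel (0::real)) = 0" by (subst val) simp_all
qed

lemma centered_gaussian_moments:
  assumes "v \<ge> 0"
  shows "integrable (centered_gaussian v) (\<lambda>x. x)" "(\<integral>x. x \<partial>centered_gaussian v) = 0"
    "integrable (centered_gaussian v) (\<lambda>x. x\<^sup>2)" "(\<integral>x. x\<^sup>2 \<partial>centered_gaussian v) = v"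
proof -
  have "integrable (centered_gaussian v) (\<lambda>x. x) \<and> (\<integral>x. x \<partial>centered_gaussian v) = 0 \<and>
    integrable (centered_gaussian v) (\<lambda>x. x\<^sup>2) \<and> (\<integral>x. x\<^sup>2 \<partial>centered_gaussian v) = v"
  proof (cases "v = 0")
    case True
    then have "centered_gaussian v = return borel 0" by (simp add: centered_gaussian_def)
    then show ?thesis using return_moments True by (metis (no_types))
  next
    case False
    then have v: "sqrt v > 0" using assms by simp
    have g: "centered_gaussian v = density lborel (\<lambda>x. ennreal (normal_density 0 (sqrt v) x))"
      using False by (simp add: centered_gaussian_def)
    have m2: "has_bochner_integral lborel (\<lambda>x. normal_density 0 (sqrt v) x * x\<^sup>2) v"
      using normal_moment_even[OF v, of 0 1] assms by (simp add: fact_2)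
    have "integrable (centered_gaussian v) f \<and> (\<integral>x. f x \<partial>centered_gaussian v) = c"
      if "f \<in> borel_measurable borel" "has_bochner_integral lborel (\<lambda>x. normal_density 0 (sqrt v) x * f x) c"
      for f :: "real \<Rightarrow> real" and c
      unfolding g using that by (simp add: integrable_real_density integral_real_density has_bochner_integral_iff)
    from this[OF _ m2] this[OF _ normal_moment_nz_1[OF v]] show ?thesis by simp
  qed
  then show "integrable (centered_gaussian v) (\<lambda>x. x)" "(\<integral>x. x \<partial>centered_gaussian v) = 0"
    "integrable (centered_gaussian v) (\<lambda>x. x\<^sup>2)" "(\<integral>x. x\<^sup>2 \<partial>centered_gaussian v) = v" by blast+
qed

locale Q_Wiener = prob_space M
  for M :: "'a measure" and F :: "real \<Rightarrow> 'a measure"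
    and Q :: "'h::{real_inner, banach, second_countable_topology} \<Rightarrow>\<^sub>L 'h" and W :: "real \<Rightarrow> 'h \<Rightarrow> 'a \<Rightarrow> real" +
  assumes filtration: "normal_filtration M F"
    and Q_adj: "self_adjoint Q" and Q_pos: "strictly_positive Q"
    and wiener: "cylindrical_Q_Wiener M F Q W"
begin

lemma Q_nonneg: "inner (Q x) x \<ge> 0"
proof -
  obtain \<theta> where "\<theta> > 0" "inner (Q x) x \<ge> \<theta> * (norm x)\<^sup>2" using Q_pos unfolding strictly_positive_def by blast
  then show ?thesis by (meson less_imp_le mult_nonneg_nonneg order_trans zero_le_power2)
qed

lemma W_adapted: "0 \<le> t \<Longrightarrow> W t x \<in> borel_measurable (F t)"
  using wiener[unfolded cylindrical_Q_Wiener_def, THEN conjunct1] by simp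

lemma W_measurable: "0 \<le> t \<Longrightarrow> W t x \<in> borel_measurable M"
  by (rule measurable_from_subalg[OF _ W_adapted]) (use filtration in \<open>simp_all add: normal_filtration_def\<close>)

lemma W_add: "0 \<le> t \<Longrightarrow> AE \<omega> in M. W t (x + y) \<omega> = W t x \<omega> + W t y \<omega>"
proof -
  assume t: "0 \<le> t"
  have "\<forall>t\<ge>0. \<forall>x y. \<forall>a b::real. AE \<omega> in M. W t (a *\<^sub>R x + b *\<^sub>R y) \<omega> = a * W t x \<omega> + b * W t y \<omega>"
    using wiener unfolding cylindrical_Q_Wiener_def by (elim conjE)
  from this[rule_format, OF t, of 1 x 1 y] show ?thesis by simp
qed

lemma W_0: "AE \<omega> in M. W 0 x \<omega> = 0"
  using wiener[unfolded cylindrical_Q_Wiener_def, THEN conjunct2, THEN conjunct2, THEN conjunct1] by (rule spec)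

text \<open>
  The last claim is the martingale property that makes off-diagonal terms vanish: the increment is
  independent of the past and has mean zero.
\<close>
lemma increment:
  assumes "0 \<le> s" "s < t"
  shows "square_integrable M (\<lambda>\<omega>. W t x \<omega> - W s x \<omega>)"
    and "(\<integral>\<omega>. (W t x \<omega> - W s x \<omega>) \<partial>M) = 0"
    and "(\<integral>\<omega>. (W t x \<omega> - W s x \<omega>)\<^sup>2 \<partial>M) = (t - s) * inner (Q x) x"
    and "X \<in> borel_measurable (F s) \<Longrightarrow> square_integrable M X \<Longrightarrow>
      (\<integral>\<omega>. X \<omega> * (W t x \<omega> - W s x \<omega>) \<partial>M) = 0"
proof -
  let ?D = "\<lambda>\<omega>. W t x \<omega> - W s x \<omega>"
  have [measurable]: "?D \<in> borel_measurable M" using assms by (auto intro!: borel_measurable_diff W_measurable)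
  have distr: "distr M borel ?D = centered_gaussian ((t - s) * inner (Q x) x)"
    and indep: "indep_set (sets (F s)) {?D -` B \<inter> space M |B. B \<in> sets borel}"
    using wiener assms unfolding cylindrical_Q_Wiener_def by blast+
  have "(t - s) * inner (Q x) x \<ge> 0" using assms Q_nonneg by simp
  note mom = centered_gaussian_moments[OF this, folded distr]
  show "square_integrable M ?D"
    using mom(3) by (simp add: square_integrable_def integrable_distr_eq)
  have D1: "integrable M ?D" using mom(1) by (simp add: integrable_distr_eq)
  show D0: "(\<integral>\<omega>. ?D \<omega> \<partial>M) = 0" using mom(2) by (simp add: integral_distr)
  show "(\<integral>\<omega>. (?D \<omega>)\<^sup>2 \<partial>M) = (t - s) * inner (Q x) x" using mom(4) by (simp add: integral_distr)
  assume X: "X \<in> borel_measurable (F s)" "square_integrable M X"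
  have sp: "space (F s) = space M" using filtration assms by (auto simp: normal_filtration_def subalgebra_def)
  have XM: "random_variable borel X" using X(2) by (simp add: square_integrable_def)
  have "{X -` A \<inter> space M |A. A \<in> sets borel} \<subseteq> sets (F s)"
    using measurable_sets[OF X(1)] by (auto simp: sp)
  then have "sigma_sets (space M) {X -` A \<inter> space M |A. A \<in> sets borel} \<subseteq> sets (F s)"
    using sets.sigma_sets_subset[of _ "F s"] by (simp add: sp)
  then have "indep_set (sigma_sets (space M) {X -` A \<inter> space M |A. A \<in> sets borel}) {?D -` B \<inter> space M |B. B \<in> sets borel}"
    using indep unfolding indep_sets2_eq by blast
  moreover have "sigma_sets (space M) {?D -` B \<inter> space M |B. B \<in> sets borel} = {?D -` B \<inter> space M |B. B \<in> sets borel}"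
    using sets_vimage_algebra2[of ?D "space M" borel] by (simp add: sets_vimage_algebra)
  ultimately have "indep_var borel X borel ?D"
    unfolding indep_var_eq using XM by simp
  moreover have "integrable M X"
    using square_integrable_inner[OF X(2), of "\<lambda>_. 1"] by (simp add: square_integrable_def)
  ultimately show "(\<integral>\<omega>. X \<omega> * ?D \<omega> \<partial>M) = 0"
    using indep_var_lebesgue_integral[of X ?D] D1 D0 by simp
qed

text \<open>
  Used with the increment from time 0 as \<open>f\<close>, and with \<open>f = 0\<close> for \<open>t = 0\<close>; both are versions of
  \<open>W t x\<close> because \<open>W 0 x\<close> vanishes almost surely.
\<close>
lemma W_moments_AE:
  assumes "0 \<le> t" "square_integrable M f" "AE \<omega> in M. f \<omega> = W t x \<omega>"
  shows "square_integrable M (W t x)" "(\<integral>\<omega>. W t x \<omega> \<partial>M) = (\<integral>\<omega>. f \<omega> \<partial>M)"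
    "(\<integral>\<omega>. (W t x \<omega>)\<^sup>2 \<partial>M) = (\<integral>\<omega>. (f \<omega>)\<^sup>2 \<partial>M)"
proof -
  have m: "f \<in> borel_measurable M" "W t x \<in> borel_measurable M"
    using assms(2) W_measurable[OF assms(1)] unfolding square_integrable_def by blast+
  have m2: "(\<lambda>\<omega>. (f \<omega>)\<^sup>2) \<in> borel_measurable M" "(\<lambda>\<omega>. (W t x \<omega>)\<^sup>2) \<in> borel_measurable M"
    by (intro borel_measurable_power m)+
  have eq: "AE \<omega> in M. W t x \<omega> = f \<omega>" "AE \<omega> in M. (W t x \<omega>)\<^sup>2 = (f \<omega>)\<^sup>2"
    by (rule eventually_mono[OF assms(3)], simp)+
  show "(\<integral>\<omega>. W t x \<omega> \<partial>M) = (\<integral>\<omega>. f \<omega> \<partial>M)" by (rule integral_cong_AE[OF m(2,1) eq(1)])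
  show "(\<integral>\<omega>. (W t x \<omega>)\<^sup>2 \<partial>M) = (\<integral>\<omega>. (f \<omega>)\<^sup>2 \<partial>M)" by (rule integral_cong_AE[OF m2(2,1) eq(2)])
  have "integrable M (\<lambda>\<omega>. (W t x \<omega>)\<^sup>2) = integrable M (\<lambda>\<omega>. (f \<omega>)\<^sup>2)"
    by (rule integrable_cong_AE[OF m2(2,1) eq(2)])
  then show "square_integrable M (W t x)"
    using assms(2) m(2) by (simp add: square_integrable_def)
qed

lemma W_moments:
  assumes "0 \<le> t"
  shows "square_integrable M (W t x)" "(\<integral>\<omega>. W t x \<omega> \<partial>M) = 0" "(\<integral>\<omega>. (W t x \<omega>)\<^sup>2 \<partial>M) = t * inner (Q x) x"
proof -
  have sq0: "square_integrable M (\<lambda>_. 0 :: real)" by (simp add: square_integrable_def)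
  have W0: "AE \<omega> in M. 0 = W 0 x \<omega>" using W_0[of x] by eventually_elim simp
  have "square_integrable M (W t x) \<and> (\<integral>\<omega>. W t x \<omega> \<partial>M) = 0 \<and> (\<integral>\<omega>. (W t x \<omega>)\<^sup>2 \<partial>M) = t * inner (Q x) x"
  proof (cases "t > 0")
    case True
    have "AE \<omega> in M. W t x \<omega> - W 0 x \<omega> = W t x \<omega>" using W0 by eventually_elim simp
    note W_moments_AE[OF assms increment(1)[OF order_refl True] this]
    then show ?thesis using increment(2,3)[OF order_refl True, of x] by simp
  next
    case False
    then have t: "t = 0" using assms by linarith
    show ?thesis unfolding t using W_moments_AE[OF order_refl sq0 W0] by simp
  qed
  then show "square_integrable M (W t x)" "(\<integral>\<omega>. W t x \<omega> \<partial>M) = 0" "(\<integral>\<omega>. (W t x \<omega>)\<^sup>2 \<partial>M) = t * inner (Q x) x"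
    by blast+
qed

lemma W_product_integrable:
  assumes "0 \<le> s" "0 \<le> t"
  shows "integrable M (\<lambda>\<omega>. W s x \<omega> * W t y \<omega>)"
  using square_integrable_inner[OF W_moments(1)[OF assms(1)] W_moments(1)[OF assms(2)]] by simp

text \<open>
  For \<open>s = t\<close> the variances of \<open>W s x\<close>, \<open>W s y\<close> and \<open>W s (x + y)\<close> determine the covariance by
  polarization, using almost sure additivity. For \<open>s < t\<close> the increment after \<open>s\<close> contributes
  nothing.
\<close>
lemma W_covariance:
  assumes "0 \<le> s" "0 \<le> t"
  shows "(\<integral>\<omega>. W s x \<omega> * W t y \<omega> \<partial>M) = min s t * inner (Q x) y"
proof -
  have same: "(\<integral>\<omega>. W s x \<omega> * W s y \<omega> \<partial>M) = s * inner (Q x) y" if "0 \<le> s" for s x y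
  proof -
    note [measurable] = W_measurable[OF that]
    note I = W_product_integrable[OF that that]
    have "s * inner (Q (x + y)) (x + y) = (\<integral>\<omega>. (W s x \<omega> + W s y \<omega>)\<^sup>2 \<partial>M)"
      unfolding W_moments(3)[OF that, symmetric] using W_add[OF that, of x y]
      by (intro integral_cong_AE) (auto elim: eventually_mono)
    also have "\<dots> = (\<integral>\<omega>. (W s x \<omega> * W s x \<omega> + 2 * (W s x \<omega> * W s y \<omega>) + W s y \<omega> * W s y \<omega>) \<partial>M)"
      by (intro Bochner_Integration.integral_cong) (auto simp: power2_eq_square algebra_simps)
    also have "\<dots> = s * inner (Q x) x + 2 * (\<integral>\<omega>. W s x \<omega> * W s y \<omega> \<partial>M) + s * inner (Q y) y"
      using I W_moments(3)[OF that] by (simp add: power2_eq_square)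
    finally show ?thesis
      using self_adjointD[OF Q_adj, of y x]
      by (simp add: blinfun.bilinear_simps inner_add_left inner_add_right inner_commute algebra_simps)
  qed
  have less: "(\<integral>\<omega>. W s x \<omega> * W t y \<omega> \<partial>M) = s * inner (Q x) y" if "0 \<le> s" "s < t" for s t x y
  proof -
    have "0 \<le> t" using that by simp
    note I = W_product_integrable[OF that(1) \<open>0 \<le> t\<close>] W_product_integrable[OF that(1) that(1)]
    have "0 = (\<integral>\<omega>. W s x \<omega> * (W t y \<omega> - W s y \<omega>) \<partial>M)"
      using increment(4)[OF that W_adapted[OF that(1)] W_moments(1)[OF that(1)]] by simp
    also have "\<dots> = (\<integral>\<omega>. W s x \<omega> * W t y \<omega> \<partial>M) - s * inner (Q x) y"
      using I same[OF that(1)] by (simp add: right_diff_distrib)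
    finally show ?thesis by simp
  qed
  consider "s < t" | "s = t" | "t < s" by linarith
  then show ?thesis
  proof cases
    case 3
    have "(\<integral>\<omega>. W s x \<omega> * W t y \<omega> \<partial>M) = (\<integral>\<omega>. W t y \<omega> * W s x \<omega> \<partial>M)" by (simp add: mult.commute)
    then show ?thesis using less[OF assms(2) 3, of y x] 3 self_adjointD[OF Q_adj, of y x] by (simp add: inner_commute)
  qed (use assms less same in auto)
qed

end

section \<open>The Ito isometry for step functions\<close>

text \<open>
  The right-hand side is the combination of minima that arises from the covariances
  \<open>min s t\<close> when the product of two increments is expanded.
\<close>
lemma integral_indicator_Ioc_times:
  fixes a b c d :: real
  assumes "a \<le> b" "c \<le> d"
  shows "(\<integral>r. indicator {a<..b} r * indicator {c<..d} r \<partial>lborel) = min b d - min b c - min a d + min a c"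
proof -
  have "(\<lambda>r. indicator {a<..b} r * indicator {c<..d} r :: real) = indicator ({a<..b} \<inter> {c<..d})"
    by (auto simp: indicator_def)
  moreover have "{a<..b} \<inter> {c<..d} = {max a c<..min b d}" by auto
  ultimately have "(\<integral>r. indicator {a<..b} r * indicator {c<..d} r \<partial>lborel) = measure lborel {max a c<..min b d}"
    by simp
  also have "\<dots> = max 0 (min b d - max a c)"
    by (cases "max a c \<le> min b d") (auto simp: measure_lborel_Ioc)
  also have "\<dots> = min b d - min b c - min a d + min a c" using assms by linarith
  finally show ?thesis .
qed

lemma square_integrable_scaleR_const:
  fixes f :: "'a \<Rightarrow> real"
  shows "square_integrable M f \<Longrightarrow> square_integrable M (\<lambda>\<omega>. f \<omega> *\<^sub>R y)"
  by (auto simp: square_integrable_def power_mult_distrib)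

text \<open>
  The adjoint of the step operator at time \<open>s\<close>, applied to \<open>z\<close>. Working with the adjoint turns
  operator-valued integrands into vector-valued ones:
  \<open>(\<integral> \<Phi> dW, z) = \<integral> (\<Phi>\<^sup>* z, dW)\<close>.
\<close>
definition adjoint_step :: "'h::real_inner step \<Rightarrow> 'h \<Rightarrow> real \<Rightarrow> 'h" where
  "adjoint_step l z s = (\<Sum>(a, b, x, y)\<leftarrow>l. (indicator {a<..b} s * inner y z) *\<^sub>R x)"

lemma adjoint_step_simps:
  "adjoint_step [] z s = 0"
  "adjoint_step ((a, b, x, y) # l) z s = (indicator {a<..b} s * inner y z) *\<^sub>R x + adjoint_step l z s"
  by (simp_all add: adjoint_step_def)

lemma step_integral_simps:
  "step_integral W [] \<omega> = 0"
  "step_integral W ((a, b, x, y) # l) \<omega> = (W b x \<omega> - W a x \<omega>) *\<^sub>R y + step_integral W l \<omega>"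
  by (simp_all add: step_integral_def)

lemma step_on_simps:
  "step_on T []"
  "step_on T ((a, b, x, y) # l) \<longleftrightarrow> 0 \<le> a \<and> a \<le> b \<and> b \<le> T \<and> step_on T l"
  by (auto simp: step_on_def)

lemma inner_step_fun: "inner (step_fun l s u) z = inner u (adjoint_step l z s)"
proof (induction l)
  case Nil
  show ?case by (simp add: step_fun_def adjoint_step_def)
next
  case (Cons q l)
  obtain a b x y where q: "q = (a, b, x, y)" by (cases q)
  have "step_fun (q # l) s u = indicator {a<..b} s *\<^sub>R inner u x *\<^sub>R y + step_fun l s u"
    by (simp add: step_fun_def q blinfun.bilinear_simps inner_commute)
  then show ?case using Cons.IH
    by (simp add: q adjoint_step_simps inner_add_left inner_add_right inner_commute)
qed

lemma adjoint_step_outside: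
  "step_on T l \<Longrightarrow> s \<notin> {0..T} \<Longrightarrow> adjoint_step l z s = 0"
  by (induction l) (auto simp: adjoint_step_simps step_on_simps indicator_def)

lemma square_integrable_indicator_Ioc: "square_integrable lborel (\<lambda>r::real. indicator {a<..b} r *\<^sub>R x)"
proof -
  have "(indicator {a<..b} s :: real)\<^sup>2 = indicator {a<..b} s" for s by (simp add: indicator_def)
  moreover have "emeasure lborel {a<..b} < \<infinity>" by (cases "a \<le> b") auto
  ultimately have "square_integrable lborel (indicator {a<..b} :: real \<Rightarrow> real)"
    by (simp add: square_integrable_def)
  then show ?thesis by (rule square_integrable_scaleR_const)
qed

lemma adjoint_step_square_integrable:
  fixes l :: "'h::{real_inner, banach, second_countable_topology} step" and R :: "'h \<Rightarrow>\<^sub>L 'h"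
  shows "square_integrable lborel (\<lambda>s. R (adjoint_step l z s))"
proof (induction l)
  case (Cons q l)
  obtain a b x y where q: "q = (a, b, x, y)" by (cases q)
  from square_integrable_indicator_Ioc[of a b "inner y z *\<^sub>R R x"] show ?case
    using Cons.IH by (simp add: q adjoint_step_simps blinfun.bilinear_simps square_integrable_add)
qed (simp add: adjoint_step_simps square_integrable_def)

context Q_Wiener
begin

lemma step_integral_square_integrable: "step_on T l \<Longrightarrow> square_integrable M (step_integral W l)"
proof (induction l)
  case (Cons q l)
  obtain a b x y where q: "q = (a, b, x, y)" by (cases q)
  have *: "0 \<le> a" "0 \<le> b" "step_on T l" using Cons.prems by (auto simp: q step_on_simps)
  show ?case unfolding q step_integral_simps
    by (intro square_integrable_add square_integrable_scaleR_const square_integrable_diff W_moments * Cons.IH)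
qed (simp add: step_integral_def[abs_def] square_integrable_def)

lemma inner_step_integral_square_integrable:
  assumes "step_on T l"
  shows "square_integrable M (\<lambda>\<omega>. inner (step_integral W l \<omega>) z)"
  using assms
proof (induction l)
  case (Cons q l)
  obtain a b x y where q: "q = (a, b, x, y)" by (cases q)
  have *: "0 \<le> a" "0 \<le> b" "step_on T l" using Cons.prems by (auto simp: q step_on_simps)
  have "square_integrable M (\<lambda>\<omega>. (W b x \<omega> - W a x \<omega>) *\<^sub>R inner y z)"
    by (intro square_integrable_scaleR_const square_integrable_diff W_moments *)
  from square_integrable_add[OF this Cons.IH[OF *(3)]] show ?case
    by (simp add: q step_integral_simps inner_add_left)
qed (simp add: step_integral_def square_integrable_def)

lemma expectation_step_integral:
  assumes "step_on T l"
  shows "(\<integral>\<omega>. inner (step_integral W l \<omega>) z \<partial>M) = 0"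
  using assms
proof (induction l)
  case (Cons q l)
  obtain a b x y where q: "q = (a, b, x, y)" by (cases q)
  have *: "0 \<le> a" "0 \<le> b" "step_on T l" using Cons.prems by (auto simp: q step_on_simps)
  have int: "integrable M f" if "square_integrable M f" for f :: "'a \<Rightarrow> real"
    using square_integrable_inner[OF that, of "\<lambda>_. 1"] by (simp add: square_integrable_def)
  show ?case
    using int[OF inner_step_integral_square_integrable[OF *(3), of z]] int[OF W_moments(1)[OF *(1)]]
      int[OF W_moments(1)[OF *(2)]] W_moments(2) * Cons.IH
    by (simp add: q step_integral_simps inner_add_left)
qed (simp add: step_integral_def)

lemma increment_covariance:
  assumes "0 \<le> a" "a \<le> b" "0 \<le> c" "c \<le> d"
  shows "(\<integral>\<omega>. (W b x \<omega> - W a x \<omega>) * (W d y \<omega> - W c y \<omega>) \<partial>M)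
    = (\<integral>r. indicator {a<..b} r * indicator {c<..d} r \<partial>lborel) * inner (Q x) y"
proof -
  have "0 \<le> b" "0 \<le> d" using assms by auto
  then show ?thesis
    using assms
    by (simp add: integral_indicator_Ioc_times left_diff_distrib right_diff_distrib W_product_integrable
        W_covariance distrib_right)
qed

text \<open>
  Both sides are bilinear in the lists, so that two inductions reduce the claim to a pair of
  increments.
\<close>
lemma step_Ito_isometry:
  assumes R: "self_adjoint R" "R o\<^sub>L R = Q"
  assumes "step_on T l" "step_on T' l'"
  shows "(\<integral>\<omega>. inner (step_integral W l \<omega>) z * inner (step_integral W l' \<omega>) z' \<partial>M)
    = (\<integral>r. inner (R (adjoint_step l z r)) (R (adjoint_step l' z' r)) \<partial>lborel)"
proof -
  have RR: "inner (R x) (R y) = inner (Q x) y" for x y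
    using self_adjointD[OF R(1), of "R x" y] R(2) by auto
  note Ind = square_integrable_indicator_Ioc[of _ _ "blinfun_apply R _"]
  have D: "square_integrable M (\<lambda>\<omega>. W b x \<omega> - W a x \<omega>)" if "0 \<le> a" "a \<le> b" for a b x
    using that by (intro square_integrable_diff W_moments) auto
  have one: "(\<integral>\<omega>. (W b x \<omega> - W a x \<omega>) * inner (step_integral W l \<omega>) z \<partial>M)
    = (\<integral>r. inner (indicator {a<..b} r *\<^sub>R R x) (R (adjoint_step l z r)) \<partial>lborel)"
    if ab: "0 \<le> a" "a \<le> b" and "step_on T l" for a b x l T z
    using that(3)
  proof (induction l)
    case (Cons q l)
    obtain c d u y where q: "q = (c, d, u, y)" by (cases q)
    have *: "0 \<le> c" "c \<le> d" "step_on T l" using Cons.prems by (auto simp: q step_on_simps)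
    have i1: "integrable M (\<lambda>\<omega>. (W b x \<omega> - W a x \<omega>) * (W d u \<omega> - W c u \<omega>))"
      using square_integrable_inner[OF D[OF ab] D[OF *(1,2)]] by simp
    have i2: "integrable M (\<lambda>\<omega>. (W b x \<omega> - W a x \<omega>) * inner (step_integral W l \<omega>) z)"
      using square_integrable_inner[OF D[OF ab] inner_step_integral_square_integrable[OF *(3)]] by simp
    note j1 = square_integrable_inner[OF Ind[of a b x] Ind[of c d u]]
    note j2 = square_integrable_inner[OF Ind[of a b x] adjoint_step_square_integrable[of R l z]]
    have "(\<integral>\<omega>. (W b x \<omega> - W a x \<omega>) * inner (step_integral W (q # l) \<omega>) z \<partial>M)
      = (\<integral>\<omega>. inner y z * ((W b x \<omega> - W a x \<omega>) * (W d u \<omega> - W c u \<omega>)) + (W b x \<omega> - W a x \<omega>) * inner (step_integral W l \<omega>) z \<partial>M)"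
      by (intro Bochner_Integration.integral_cong) (auto simp: q step_integral_simps inner_add_left distrib_left)
    also have "\<dots> = inner y z * ((\<integral>r. indicator {a<..b} r * indicator {c<..d} r \<partial>lborel) * inner (Q x) u)
        + (\<integral>r. inner (indicator {a<..b} r *\<^sub>R R x) (R (adjoint_step l z r)) \<partial>lborel)"
      using i1 i2 Cons.IH[OF *(3)] increment_covariance[OF ab *(1,2), of x u] by simp
    also have "(\<integral>r. indicator {a<..b} r * indicator {c<..d} r \<partial>lborel) * inner (Q x) u
      = (\<integral>r. inner (indicator {a<..b} r *\<^sub>R R x) (indicator {c<..d} r *\<^sub>R R u) \<partial>lborel)"
      unfolding integral_mult_left_zero[symmetric]
      by (intro Bochner_Integration.integral_cong) (simp_all add: RR)
    also have "inner y z * \<dots> + (\<integral>r. inner (indicator {a<..b} r *\<^sub>R R x) (R (adjoint_step l z r)) \<partial>lborel)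
      = (\<integral>r. inner y z * inner (indicator {a<..b} r *\<^sub>R R x) (indicator {c<..d} r *\<^sub>R R u)
          + inner (indicator {a<..b} r *\<^sub>R R x) (R (adjoint_step l z r)) \<partial>lborel)"
      using Bochner_Integration.integral_add[OF integrable_mult_right[OF j1, of "inner y z"] j2] by simp
    also have "\<dots> = (\<integral>r. inner (indicator {a<..b} r *\<^sub>R R x) (R (adjoint_step (q # l) z r)) \<partial>lborel)"
      by (intro Bochner_Integration.integral_cong)
        (auto simp: q adjoint_step_simps blinfun.bilinear_simps inner_add_right)
    finally show ?case .
  qed (simp add: step_integral_def adjoint_step_def)
  show ?thesis using assms(3)
  proof (induction l)
    case (Cons q l)
    obtain a b x y where q: "q = (a, b, x, y)" by (cases q)
    have *: "0 \<le> a" "a \<le> b" "step_on T l" using Cons.prems by (auto simp: q step_on_simps)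
    let ?J = "\<lambda>\<omega>. inner (step_integral W l' \<omega>) z'" and ?j = "\<lambda>r. R (adjoint_step l' z' r)"
    have i1: "integrable M (\<lambda>\<omega>. (W b x \<omega> - W a x \<omega>) * ?J \<omega>)"
      using square_integrable_inner[OF D[OF *(1,2)] inner_step_integral_square_integrable[OF assms(4)]] by simp
    have i2: "integrable M (\<lambda>\<omega>. inner (step_integral W l \<omega>) z * ?J \<omega>)"
      using square_integrable_inner[OF inner_step_integral_square_integrable[OF *(3)]
          inner_step_integral_square_integrable[OF assms(4)]] by simp
    note j1 = square_integrable_inner[OF Ind[of a b x] adjoint_step_square_integrable[of R l' z']]
    note j2 = square_integrable_inner[OF adjoint_step_square_integrable[of R l z] adjoint_step_square_integrable[of R l' z']]
    have "(\<integral>\<omega>. inner (step_integral W (q # l) \<omega>) z * ?J \<omega> \<partial>M)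
      = (\<integral>\<omega>. inner y z * ((W b x \<omega> - W a x \<omega>) * ?J \<omega>) + inner (step_integral W l \<omega>) z * ?J \<omega> \<partial>M)"
      by (intro Bochner_Integration.integral_cong) (auto simp: q step_integral_simps inner_add_left distrib_right)
    also have "\<dots> = inner y z * (\<integral>r. inner (indicator {a<..b} r *\<^sub>R R x) (?j r) \<partial>lborel)
        + (\<integral>r. inner (R (adjoint_step l z r)) (?j r) \<partial>lborel)"
      using i1 i2 Cons.IH[OF *(3)] one[OF *(1,2) assms(4), of x z'] by simp
    also have "\<dots> = (\<integral>r. inner y z * inner (indicator {a<..b} r *\<^sub>R R x) (?j r) + inner (R (adjoint_step l z r)) (?j r) \<partial>lborel)"
      using Bochner_Integration.integral_add[OF integrable_mult_right[OF j1, of "inner y z"] j2] by simp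
    also have "\<dots> = (\<integral>r. inner (R (adjoint_step (q # l) z r)) (?j r) \<partial>lborel)"
      by (intro Bochner_Integration.integral_cong)
        (auto simp: q adjoint_step_simps blinfun.bilinear_simps inner_add_left)
    finally show ?case .
  qed (simp add: step_integral_def adjoint_step_def)
qed

end

section \<open>Stochastic integrals of scalar integrands\<close>

text \<open>
  For a measurable \<open>g\<close> this would be monotonicity and linearity. Here \<open>g\<close> will be \<open>hs_norm_sq\<close>
  along a path of operators, so the constant is pulled out of the integral of \<open>f\<close> instead.
\<close>
lemma nn_integral_le_cmult:
  fixes f g :: "'a \<Rightarrow> ennreal" and c :: real
  assumes f: "f \<in> borel_measurable M" and c: "c \<ge> 0" and le: "\<And>x. f x \<le> ennreal c * g x"
  shows "(\<integral>\<^sup>+x. f x \<partial>M) \<le> ennreal c * (\<integral>\<^sup>+x. g x \<partial>M)"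
proof (cases "c = 0")
  case True
  then have "f x = 0" for x using le[of x] by simp
  then show ?thesis by simp
next
  case False
  then have c: "c > 0" using c by simp
  have inv: "ennreal (1 / c) * (ennreal c * u) = u" "ennreal c * (ennreal (1 / c) * u) = u" for u
    using c by (simp_all add: mult.assoc[symmetric] ennreal_mult[symmetric])
  have "ennreal (1 / c) * (\<integral>\<^sup>+x. f x \<partial>M) = (\<integral>\<^sup>+x. ennreal (1 / c) * f x \<partial>M)"
    using f by (rule nn_integral_cmult[symmetric])
  also have "\<dots> \<le> (\<integral>\<^sup>+x. g x \<partial>M)"
    using mult_left_mono[OF le, of "ennreal (1 / c)"] by (intro nn_integral_mono) (simp add: inv)
  finally show ?thesis using mult_left_mono[of "ennreal (1 / c) * (\<integral>\<^sup>+x. f x \<partial>M)" _ "ennreal c"]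
    by (simp add: inv)
qed

lemma (in finite_measure) square_integrable_imp_integrable:
  assumes "square_integrable M f"
  shows "integrable M f"
proof (rule Bochner_Integration.integrable_bound)
  show "integrable M (\<lambda>x. 1 + (norm (f x))\<^sup>2)" using assms by (simp add: square_integrable_def)
  show "f \<in> borel_measurable M" using assms by (simp add: square_integrable_def)
  have "norm a \<le> 1 + (norm a)\<^sup>2" for a :: 'b
    using sum_squares_bound[of 1 "norm a"] norm_ge_zero[of a] unfolding one_power2 by linarith
  then show "AE x in M. norm (f x) \<le> norm (1 + (norm (f x))\<^sup>2)" by simp
qed

text \<open>
  With \<open>A = (c - \<Phi>) R\<close> the vector on the left is \<open>w = A\<^sup>* z\<close>, and an adjoint has the same operator
  norm: \<open>|w|\<^sup>2 = (A w, z) \<le> |A w| |z|\<close>. The operator norm of \<open>A\<close> is bounded by its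
  Hilbert--Schmidt norm.
\<close>
lemma adjoint_error_le_hs_norm_sq:
  fixes R :: "'h::{real_inner, banach, second_countable_topology} \<Rightarrow>\<^sub>L 'h"
  assumes "self_adjoint R"
  shows "ennreal ((norm (R (c *\<^sub>R z) - R (adjoint_step l z s)))\<^sup>2)
    \<le> ennreal ((norm z)\<^sup>2) * hs_norm_sq ((c *\<^sub>R id_blinfun - step_fun l s) o\<^sub>L R)"
proof -
  define w where "w = R (c *\<^sub>R z - adjoint_step l z s)"
  define A where "A = (c *\<^sub>R id_blinfun - step_fun l s) o\<^sub>L R"
  have "inner w w = inner (R w) (c *\<^sub>R z - adjoint_step l z s)"
    using self_adjointD[OF assms, of w] by (simp add: w_def)
  also have "\<dots> = inner (A w) z"
    by (simp add: A_def blinfun.bilinear_simps inner_diff_left inner_diff_right inner_step_fun)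
  finally have "inner w w \<le> norm (A w) * norm z" using norm_cauchy_schwarz[of "A w" z] by simp
  then have "(norm w)\<^sup>2 * (norm w)\<^sup>2 \<le> (norm (A w) * norm z) * (norm (A w) * norm z)"
    unfolding power2_norm_eq_inner by (intro mult_mono) auto
  then have le: "(norm w)\<^sup>2 * (norm w)\<^sup>2 \<le> (norm (A w))\<^sup>2 * (norm z)\<^sup>2" by (simp add: power2_eq_square mult_ac)
  have "ennreal ((norm w)\<^sup>2) \<le> ennreal ((norm z)\<^sup>2) * hs_norm_sq A"
  proof (cases "w = 0 \<or> (hs_norm_sq A = \<top> \<and> z \<noteq> 0)")
    case True
    then show ?thesis by (auto simp: ennreal_mult_top)
  next
    case False
    moreover have "z \<noteq> 0" using le False by auto
    ultimately obtain h where h: "hs_norm_sq A = ennreal h" "h \<ge> 0" "w \<noteq> 0"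
      by (cases "hs_norm_sq A") auto
    have "(norm (A w))\<^sup>2 \<le> (norm w)\<^sup>2 * h"
      using norm_le_hs_norm_sq[of A w] h by (simp add: ennreal_mult[symmetric])
    then have "(norm w)\<^sup>2 * (norm w)\<^sup>2 \<le> ((norm w)\<^sup>2 * h) * (norm z)\<^sup>2"
      using le by (meson mult_right_mono order_trans zero_le_power2)
    then have "(norm w)\<^sup>2 * (norm w)\<^sup>2 \<le> (norm w)\<^sup>2 * ((norm z)\<^sup>2 * h)" by (simp only: mult_ac)
    then have "(norm w)\<^sup>2 \<le> (norm z)\<^sup>2 * h" using h(3) by (simp only: mult_le_cancel_left_pos zero_less_power2 zero_less_norm_iff norm_eq_zero simp_thms)
    then show ?thesis using h by (simp add: ennreal_mult[symmetric])
  qed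
  then show ?thesis by (simp add: w_def A_def blinfun.diff_right)
qed

context Q_Wiener
begin

text \<open>
  The approximating step functions of a scalar integrand \<open>\<phi>\<close>, with the Hilbert--Schmidt error
  replaced by the error of the adjoints at each vector \<open>z\<close>. The indicator extends the integrand
  from \<open>[0, T]\<close> to the whole line, where integrals over different intervals can be compared.
\<close>
lemma stochastic_integral_approximation:
  assumes int: "has_stochastic_integral M Q W T (\<lambda>s. \<phi> s *\<^sub>R id_blinfun) Y"
  obtains l where "\<And>n. step_on T (l n)"
    "\<And>z. (\<lambda>r. op_sqrt Q ((indicator {0..T} r * \<phi> r) *\<^sub>R z)) \<in> borel_measurable lborel"
    "\<And>z. (\<lambda>n. \<integral>\<^sup>+r. ennreal ((norm (op_sqrt Q ((indicator {0..T} r * \<phi> r) *\<^sub>R z)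
        - op_sqrt Q (adjoint_step (l n) z r)))\<^sup>2) \<partial>lborel) \<longlonglongrightarrow> 0"
    "Y \<in> borel_measurable M"
    "(\<lambda>n. \<integral>\<^sup>+\<omega>. ennreal ((norm (Y \<omega> - step_integral W (l n) \<omega>))\<^sup>2) \<partial>M) \<longlonglongrightarrow> 0"
proof -
  define R where "R = op_sqrt Q"
  have R: "self_adjoint R" unfolding R_def by (rule op_sqrt[OF Q_adj Q_pos])
  note hs = int[unfolded has_stochastic_integral_def, folded R_def]
  have meas0: "\<And>x. set_borel_measurable lborel {0..T} (\<lambda>s. (\<phi> s *\<^sub>R id_blinfun) (x :: 'h))"
    using hs[THEN conjunct1] by (rule spec)
  have Y: "Y \<in> borel_measurable M" by (rule hs[THEN conjunct2, THEN conjunct1])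
  obtain l where l: "\<And>n. step_on T (l n)"
      "(\<lambda>n. \<integral>\<^sup>+s\<in>{0..T}. hs_norm_sq ((\<phi> s *\<^sub>R id_blinfun - step_fun (l n) s) o\<^sub>L R) \<partial>lborel) \<longlonglongrightarrow> 0"
      "(\<lambda>n. \<integral>\<^sup>+\<omega>. ennreal ((norm (Y \<omega> - step_integral W (l n) \<omega>))\<^sup>2) \<partial>M) \<longlonglongrightarrow> 0"
    using hs[THEN conjunct2, THEN conjunct2] by blast
  have meas: "(\<lambda>r. R ((indicator {0..T} r * \<phi> r) *\<^sub>R z)) \<in> borel_measurable lborel" for z
  proof -
    have "(\<lambda>r. (indicator {0..T} r * \<phi> r) *\<^sub>R z) \<in> borel_measurable lborel"
      using meas0[of z] by (simp add: set_borel_measurable_def blinfun.bilinear_simps)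
    then show ?thesis
      by (rule borel_measurable_continuous_on[OF linear_continuous_on[OF blinfun.bounded_linear_right]])
  qed
  have lim: "(\<lambda>n. \<integral>\<^sup>+r. ennreal ((norm (R ((indicator {0..T} r * \<phi> r) *\<^sub>R z)
        - R (adjoint_step (l n) z r)))\<^sup>2) \<partial>lborel) \<longlonglongrightarrow> 0" for z
  proof -
    define h where "h n = (\<integral>\<^sup>+s\<in>{0..T}. hs_norm_sq ((\<phi> s *\<^sub>R id_blinfun - step_fun (l n) s) o\<^sub>L R) \<partial>lborel)" for n
    have le: "(\<integral>\<^sup>+r. ennreal ((norm (R ((indicator {0..T} r * \<phi> r) *\<^sub>R z) - R (adjoint_step (l n) z r)))\<^sup>2) \<partial>lborel)
      \<le> ennreal ((norm z)\<^sup>2) * h n" for n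
      unfolding h_def
    proof (rule nn_integral_le_cmult)
      note [measurable] = meas[of z] square_integrable_measurable[OF adjoint_step_square_integrable[of R "l n" z]]
      show "(\<lambda>r. ennreal ((norm (R ((indicator {0..T} r * \<phi> r) *\<^sub>R z) - R (adjoint_step (l n) z r)))\<^sup>2)) \<in> borel_measurable lborel"
        by measurable
      fix r
      show "ennreal ((norm (R ((indicator {0..T} r * \<phi> r) *\<^sub>R z) - R (adjoint_step (l n) z r)))\<^sup>2)
        \<le> ennreal ((norm z)\<^sup>2) * (hs_norm_sq ((\<phi> r *\<^sub>R id_blinfun - step_fun (l n) r) o\<^sub>L R) * indicator {0..T} r)"
      proof (cases "r \<in> {0..T}")
        case True
        then show ?thesis using adjoint_error_le_hs_norm_sq[OF R, of "\<phi> r" z "l n" r] by simp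
      next
        case False
        then show ?thesis using adjoint_step_outside[OF l(1) False] by simp
      qed
    qed simp
    have "(\<lambda>n. ennreal ((norm z)\<^sup>2) * h n) \<longlonglongrightarrow> ennreal ((norm z)\<^sup>2) * 0"
      using l(2) unfolding h_def by (intro ennreal_tendsto_cmult) auto
    then have "(\<lambda>n. ennreal ((norm z)\<^sup>2) * h n) \<longlonglongrightarrow> 0" by simp
    then show ?thesis
      by (rule tendsto_sandwich[OF _ _ tendsto_const, rotated 2]) (use le in auto)
  qed
  show ?thesis using that[OF l(1) meas[unfolded R_def] lim[unfolded R_def] Y l(3)] .
qed

lemma inner_step_integral_tendsto:
  assumes Y: "Y \<in> borel_measurable M" and l: "\<And>n. step_on T (l n)"
    and lim: "(\<lambda>n. \<integral>\<^sup>+\<omega>. ennreal ((norm (Y \<omega> - step_integral W (l n) \<omega>))\<^sup>2) \<partial>M) \<longlonglongrightarrow> 0"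
  shows "(\<lambda>n. \<integral>\<^sup>+\<omega>. ennreal ((norm (inner (Y \<omega>) x - inner (step_integral W (l n) \<omega>) x))\<^sup>2) \<partial>M) \<longlonglongrightarrow> 0"
proof -
  define h where "h n = (\<integral>\<^sup>+\<omega>. ennreal ((norm (Y \<omega> - step_integral W (l n) \<omega>))\<^sup>2) \<partial>M)" for n
  have le: "(\<integral>\<^sup>+\<omega>. ennreal ((norm (inner (Y \<omega>) x - inner (step_integral W (l n) \<omega>) x))\<^sup>2) \<partial>M)
      \<le> ennreal ((norm x)\<^sup>2) * h n" for n
    unfolding h_def
  proof (rule nn_integral_le_cmult)
    note [measurable] = Y square_integrable_measurable[OF step_integral_square_integrable[OF l[of n]]]
    show "(\<lambda>\<omega>. ennreal ((norm (inner (Y \<omega>) x - inner (step_integral W (l n) \<omega>) x))\<^sup>2)) \<in> borel_measurable M"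
      by measurable
    fix \<omega>
    have "(norm (inner (Y \<omega>) x - inner (step_integral W (l n) \<omega>) x))\<^sup>2 \<le> (norm (Y \<omega> - step_integral W (l n) \<omega>) * norm x)\<^sup>2"
      unfolding inner_diff_left[symmetric] real_norm_def by (intro power_mono Cauchy_Schwarz_ineq2) auto
    then show "ennreal ((norm (inner (Y \<omega>) x - inner (step_integral W (l n) \<omega>) x))\<^sup>2)
      \<le> ennreal ((norm x)\<^sup>2) * ennreal ((norm (Y \<omega> - step_integral W (l n) \<omega>))\<^sup>2)"
      by (simp add: ennreal_mult[symmetric] power_mult_distrib mult.commute ennreal_leI)
  qed simp
  have "(\<lambda>n. ennreal ((norm x)\<^sup>2) * h n) \<longlonglongrightarrow> ennreal ((norm x)\<^sup>2) * 0"
    using lim unfolding h_def by (intro ennreal_tendsto_cmult) auto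
  then have "(\<lambda>n. ennreal ((norm x)\<^sup>2) * h n) \<longlonglongrightarrow> 0" by simp
  then show ?thesis
    by (rule tendsto_sandwich[OF _ _ tendsto_const, rotated 2]) (use le in auto)
qed

lemma stochastic_integral_mean:
  assumes "has_stochastic_integral M Q W T (\<lambda>s. \<phi> s *\<^sub>R id_blinfun) Y"
  shows "integrable M Y" "(\<integral>\<omega>. Y \<omega> \<partial>M) = 0"
proof -
  obtain l where l: "\<And>n. step_on T (l n)"
    "\<And>z. (\<lambda>r. op_sqrt Q ((indicator {0..T} r * \<phi> r) *\<^sub>R z)) \<in> borel_measurable lborel"
    "\<And>z. (\<lambda>n. \<integral>\<^sup>+r. ennreal ((norm (op_sqrt Q ((indicator {0..T} r * \<phi> r) *\<^sub>R z)
        - op_sqrt Q (adjoint_step (l n) z r)))\<^sup>2) \<partial>lborel) \<longlonglongrightarrow> 0"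
    and Y: "Y \<in> borel_measurable M"
    and lim: "(\<lambda>n. \<integral>\<^sup>+\<omega>. ennreal ((norm (Y \<omega> - step_integral W (l n) \<omega>))\<^sup>2) \<partial>M) \<longlonglongrightarrow> 0"
    by (rule stochastic_integral_approximation[OF assms]) (rule that)
  note l = l(1)
  show int: "integrable M Y"
    using square_integrable_limit(1)[OF step_integral_square_integrable[OF l] Y lim]
    by (rule square_integrable_imp_integrable)
  have "inner (\<integral>\<omega>. Y \<omega> \<partial>M) x = 0" for x
  proof -
    have "(\<lambda>n. \<integral>\<omega>. inner (inner (step_integral W (l n) \<omega>) x) 1 \<partial>M) \<longlonglongrightarrow> (\<integral>\<omega>. inner (inner (Y \<omega>) x) 1 \<partial>M)"
      using Y by (intro integral_inner_tendsto inner_step_integral_square_integrable[OF l] inner_step_integral_tendsto[OF Y l lim])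
        (simp_all add: square_integrable_def)
    then have "(\<lambda>n. 0) \<longlonglongrightarrow> (\<integral>\<omega>. inner (Y \<omega>) x \<partial>M)"
      using expectation_step_integral[OF l] by simp
    then show ?thesis using int by (simp add: LIMSEQ_const_iff)
  qed
  from this[of "\<integral>\<omega>. Y \<omega> \<partial>M"] show "(\<integral>\<omega>. Y \<omega> \<partial>M) = 0" by simp
qed

text \<open>
  The isometry for step functions in the limit: both sides are \<open>L\<^sup>2\<close> inner products, over the
  probability space and over time, of convergent sequences. The square root \<open>R\<close> of \<open>Q\<close> makes the
  time integrand \<open>(Q u, v) = (R u, R v)\<close> such an inner product.
\<close>
lemma stochastic_integral_covariance:
  assumes "has_stochastic_integral M Q W T (\<lambda>s. \<phi> s *\<^sub>R id_blinfun) Y"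
    and "has_stochastic_integral M Q W T' (\<lambda>s. \<phi>' s *\<^sub>R id_blinfun) Y'"
  shows "(\<integral>\<omega>. inner (Y \<omega>) x * inner (Y' \<omega>) y \<partial>M)
    = (\<integral>r. (indicator {0..T} r * \<phi> r) * (indicator {0..T'} r * \<phi>' r) \<partial>lborel) * inner (Q x) y"
proof -
  define R where "R = op_sqrt Q"
  have R: "self_adjoint R" "R o\<^sub>L R = Q" unfolding R_def by (rule op_sqrt[OF Q_adj Q_pos])+
  have RR: "inner (R x) (R y) = inner (Q x) y" for x y
    using self_adjointD[OF R(1), of "R x" y] R(2) by auto
  obtain l where l: "\<And>n. step_on T (l n)"
    "\<And>z. (\<lambda>r. R ((indicator {0..T} r * \<phi> r) *\<^sub>R z)) \<in> borel_measurable lborel"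
    "\<And>z. (\<lambda>n. \<integral>\<^sup>+r. ennreal ((norm (R ((indicator {0..T} r * \<phi> r) *\<^sub>R z)
        - R (adjoint_step (l n) z r)))\<^sup>2) \<partial>lborel) \<longlonglongrightarrow> 0"
    "Y \<in> borel_measurable M"
    "(\<lambda>n. \<integral>\<^sup>+\<omega>. ennreal ((norm (Y \<omega> - step_integral W (l n) \<omega>))\<^sup>2) \<partial>M) \<longlonglongrightarrow> 0"
    using stochastic_integral_approximation[OF assms(1)] unfolding R_def by blast
  obtain l' where l': "\<And>n. step_on T' (l' n)"
    "\<And>z. (\<lambda>r. R ((indicator {0..T'} r * \<phi>' r) *\<^sub>R z)) \<in> borel_measurable lborel"
    "\<And>z. (\<lambda>n. \<integral>\<^sup>+r. ennreal ((norm (R ((indicator {0..T'} r * \<phi>' r) *\<^sub>R z)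
        - R (adjoint_step (l' n) z r)))\<^sup>2) \<partial>lborel) \<longlonglongrightarrow> 0"
    "Y' \<in> borel_measurable M"
    "(\<lambda>n. \<integral>\<^sup>+\<omega>. ennreal ((norm (Y' \<omega> - step_integral W (l' n) \<omega>))\<^sup>2) \<partial>M) \<longlonglongrightarrow> 0"
    using stochastic_integral_approximation[OF assms(2)] unfolding R_def by blast
  have m: "(\<lambda>\<omega>. inner (Y \<omega>) x) \<in> borel_measurable M" "(\<lambda>\<omega>. inner (Y' \<omega>) y) \<in> borel_measurable M"
    using l(4) l'(4) by simp_all
  have "(\<lambda>n. \<integral>\<omega>. inner (inner (step_integral W (l n) \<omega>) x) (inner (step_integral W (l' n) \<omega>) y) \<partial>M)
    \<longlonglongrightarrow> (\<integral>\<omega>. inner (inner (Y \<omega>) x) (inner (Y' \<omega>) y) \<partial>M)"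
    by (rule integral_inner_tendsto[OF inner_step_integral_square_integrable[OF l(1)] m(1)
          inner_step_integral_tendsto[OF l(4,1,5)]
          inner_step_integral_square_integrable[OF l'(1)] m(2) inner_step_integral_tendsto[OF l'(4,1,5)]])
  moreover have "(\<lambda>n. \<integral>r. inner (R (adjoint_step (l n) x r)) (R (adjoint_step (l' n) y r)) \<partial>lborel)
    \<longlonglongrightarrow> (\<integral>r. inner (R ((indicator {0..T} r * \<phi> r) *\<^sub>R x)) (R ((indicator {0..T'} r * \<phi>' r) *\<^sub>R y)) \<partial>lborel)"
    by (rule integral_inner_tendsto[OF adjoint_step_square_integrable l(2,3) adjoint_step_square_integrable l'(2,3)])
  ultimately have "(\<integral>\<omega>. inner (Y \<omega>) x * inner (Y' \<omega>) y \<partial>M)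
    = (\<integral>r. inner (R ((indicator {0..T} r * \<phi> r) *\<^sub>R x)) (R ((indicator {0..T'} r * \<phi>' r) *\<^sub>R y)) \<partial>lborel)"
    using step_Ito_isometry[OF R l(1) l'(1), of _ x _ y] LIMSEQ_unique by (simp add: inner_real_def)
  also have "\<dots> = (\<integral>r. (indicator {0..T} r * \<phi> r) * (indicator {0..T'} r * \<phi>' r) * inner (Q x) y \<partial>lborel)"
    by (intro Bochner_Integration.integral_cong) (simp_all add: blinfun.scaleR_right RR)
  finally show ?thesis by simp
qed

end

section \<open>An integral representation of the Bessel function K\<close>

lemma exp_diff_quotient_bound:
  fixes c d x y :: real
  assumes c: "c \<ge> 0" and x: "x \<ge> d" and y: "y \<ge> d" and ne: "y \<noteq> x"
  shows "\<bar>(exp (- y * c) - exp (- x * c)) / (y - x)\<bar> \<le> c * exp (- d * c)"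
proof -
  have *: "\<bar>exp (- b * c) - exp (- a * c)\<bar> \<le> (c * exp (- d * c)) * (b - a)" if "a \<le> b" "d \<le> a" for a b
  proof -
    have "exp (- b * c) = exp (- a * c) * exp (- ((b - a) * c))"
      by (simp add: exp_add[symmetric] algebra_simps)
    then have "exp (- a * c) - exp (- b * c) = exp (- a * c) * (1 - exp (- ((b - a) * c)))"
      by (simp add: algebra_simps)
    also have "\<dots> \<le> exp (- d * c) * ((b - a) * c)"
      using exp_ge_add_one_self[of "- ((b - a) * c)"] that c
      by (intro mult_mono) (auto intro: mult_right_mono)
    finally have "exp (- a * c) - exp (- b * c) \<le> (c * exp (- d * c)) * (b - a)" by (simp add: mult_ac)
    moreover have "exp (- b * c) \<le> exp (- a * c)" using that c by (simp add: mult_right_mono)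
    ultimately show ?thesis by linarith
  qed
  have "\<bar>exp (- y * c) - exp (- x * c)\<bar> \<le> (c * exp (- d * c)) * \<bar>y - x\<bar>"
  proof (cases "x \<le> y")
    case True
    then show ?thesis using *[OF True x] by simp
  next
    case False
    then show ?thesis using *[of y x] y by (simp add: abs_minus_commute)
  qed
  then show ?thesis using ne by (simp add: divide_le_eq)
qed

text \<open>
  The factor \<open>c\<close> that appears under differentiation is absorbed by half of the exponential decay.
  For the same reason the difference quotients are dominated near \<open>x\<close> by a fixed integrable
  function, namely \<open>c f e\<^sup>-\<^sup>c\<^sup>x\<^sup>/\<^sup>2\<close>.
\<close>
lemma laplace_derivative:
  fixes f c :: "real \<Rightarrow> real"
  assumes meas [measurable]: "f \<in> borel_measurable borel" "c \<in> borel_measurable borel"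
    and pos: "\<And>p. f p \<noteq> 0 \<Longrightarrow> c p \<ge> 0"
    and int: "\<And>x. x > 0 \<Longrightarrow> integrable lborel (\<lambda>p. f p * exp (- x * c p))"
    and x: "x > 0"
  shows "integrable lborel (\<lambda>p. (c p * f p) * exp (- x * c p))"
    and "((\<lambda>x. \<integral>p. f p * exp (- x * c p) \<partial>lborel) has_real_derivative
      - (\<integral>p. (c p * f p) * exp (- x * c p) \<partial>lborel)) (at x)"
proof -
  have int': "integrable lborel (\<lambda>p. (c p * f p) * exp (- x * c p))" if "x > 0" for x
  proof (rule Bochner_Integration.integrable_bound)
    show "integrable lborel (\<lambda>p. (2 / x) * (f p * exp (- (x / 2) * c p)))"
      using int[of "x / 2"] that by simp
    have "\<bar>c p * f p * exp (- x * c p)\<bar> \<le> \<bar>2 / x * (f p * exp (- (x / 2) * c p))\<bar>" for p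
    proof (cases "f p = 0")
      case False
      have "c p \<ge> 0" using pos[OF False] .
      have "(x / 2) * c p \<le> exp ((x / 2) * c p)" using exp_ge_add_one_self[of "(x / 2) * c p"] by linarith
      then have "c p \<le> (2 / x) * exp ((x / 2) * c p)" using that by (simp add: field_simps)
      then have "c p * exp (- x * c p) \<le> ((2 / x) * exp ((x / 2) * c p)) * exp (- x * c p)"
        by (intro mult_right_mono) auto
      also have "\<dots> = (2 / x) * exp (- (x / 2) * c p)"
        by (simp add: mult.assoc exp_add[symmetric])
      finally have "\<bar>f p\<bar> * (c p * exp (- x * c p)) \<le> \<bar>f p\<bar> * ((2 / x) * exp (- (x / 2) * c p))"
        by (intro mult_left_mono) auto
      then show ?thesis using \<open>c p \<ge> 0\<close> that by (simp add: abs_mult mult_ac)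
    qed simp
    then show "AE p in lborel. norm (c p * f p * exp (- x * c p)) \<le> norm (2 / x * (f p * exp (- (x / 2) * c p)))"
      by simp
  qed simp
  show "integrable lborel (\<lambda>p. (c p * f p) * exp (- x * c p))" using int'[OF x] .
  show "((\<lambda>x. \<integral>p. f p * exp (- x * c p) \<partial>lborel) has_real_derivative
      - (\<integral>p. (c p * f p) * exp (- x * c p) \<partial>lborel)) (at x)"
    unfolding has_field_derivative_iff tendsto_at_iff_sequentially
  proof (intro allI impI)
    fix X :: "nat \<Rightarrow> real"
    assume ne: "\<forall>i. X i \<in> UNIV - {x}" and X: "X \<longlonglongrightarrow> x"
    have "\<forall>\<^sub>F i in sequentially. X i > x / 2" using order_tendstoD(1)[OF X, of "x / 2"] x by simp
    then obtain N where N: "\<And>i. i \<ge> N \<Longrightarrow> X i > x / 2" by (auto simp: eventually_sequentially)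
    \<comment> \<open>the bound on the quotients holds once \<open>X\<close> stays above \<open>x / 2\<close>, hence the shift by \<open>N\<close>\<close>
    define s where "s i p = f p * ((exp (- X (i + N) * c p) - exp (- x * c p)) / (X (i + N) - x))" for i p
    have "(\<lambda>i. \<integral>p. s i p \<partial>lborel) \<longlonglongrightarrow> (\<integral>p. - ((c p * f p) * exp (- x * c p)) \<partial>lborel)"
    proof (rule integral_dominated_convergence)
      show "integrable lborel (\<lambda>p. \<bar>(c p * f p) * exp (- (x / 2) * c p)\<bar>)"
        using int'[of "x / 2"] x by simp
      show "AE p in lborel. norm (s i p) \<le> \<bar>(c p * f p) * exp (- (x / 2) * c p)\<bar>" for i
      proof (intro AE_I2)
        fix p
        show "norm (s i p) \<le> \<bar>(c p * f p) * exp (- (x / 2) * c p)\<bar>"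
        proof (cases "f p = 0")
          case False
          note c = pos[OF False]
          have "\<bar>(exp (- X (i + N) * c p) - exp (- x * c p)) / (X (i + N) - x)\<bar> \<le> c p * exp (- (x / 2) * c p)"
            using N[of "i + N"] ne x by (intro exp_diff_quotient_bound c) auto
          then have "\<bar>f p\<bar> * \<bar>(exp (- X (i + N) * c p) - exp (- x * c p)) / (X (i + N) - x)\<bar> \<le> \<bar>f p\<bar> * (c p * exp (- (x / 2) * c p))"
            by (intro mult_left_mono) auto
          then show ?thesis using c by (simp add: s_def abs_mult mult_ac)
        qed (simp add: s_def)
      qed
      show "AE p in lborel. (\<lambda>i. s i p) \<longlonglongrightarrow> - ((c p * f p) * exp (- x * c p))"
      proof (intro AE_I2)
        fix p
        have "((\<lambda>x. f p * exp (- x * c p)) has_real_derivative - ((c p * f p) * exp (- x * c p))) (at x)"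
          by (auto intro!: derivative_eq_intros)
        then have "((\<lambda>y. (f p * exp (- y * c p) - f p * exp (- x * c p)) / (y - x)) \<circ> X) \<longlonglongrightarrow> - ((c p * f p) * exp (- x * c p))"
          unfolding has_field_derivative_iff tendsto_at_iff_sequentially using ne X by blast
        from LIMSEQ_ignore_initial_segment[OF this, of N]
        show "(\<lambda>i. s i p) \<longlonglongrightarrow> - ((c p * f p) * exp (- x * c p))"
          by (simp add: s_def o_def right_diff_distrib)
      qed
    qed (simp_all add: s_def)
    moreover have "(\<integral>p. s i p \<partial>lborel) = ((\<integral>p. f p * exp (- X (i + N) * c p) \<partial>lborel) - (\<integral>p. f p * exp (- x * c p) \<partial>lborel)) / (X (i + N) - x)" for i
    proof -
      have "X (i + N) > 0" using N[of "i + N"] x by simp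
      then have "(\<integral>p. f p * exp (- X (i + N) * c p) \<partial>lborel) - (\<integral>p. f p * exp (- x * c p) \<partial>lborel)
        = (\<integral>p. f p * exp (- X (i + N) * c p) - f p * exp (- x * c p) \<partial>lborel)"
        using int int[OF x] by (intro Bochner_Integration.integral_diff[symmetric]) auto
      then show ?thesis by (simp add: s_def right_diff_distrib)
    qed
    ultimately have "(\<lambda>i. ((\<lambda>y. ((\<integral>p. f p * exp (- y * c p) \<partial>lborel) - (\<integral>p. f p * exp (- x * c p) \<partial>lborel)) / (y - x)) \<circ> X) (i + N))
      \<longlonglongrightarrow> - (\<integral>p. (c p * f p) * exp (- x * c p) \<partial>lborel)"
      by simp
    then show "((\<lambda>y. ((\<integral>p. f p * exp (- y * c p) \<partial>lborel) - (\<integral>p. f p * exp (- x * c p) \<partial>lborel)) / (y - x)) \<circ> X)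
      \<longlonglongrightarrow> - (\<integral>p. (c p * f p) * exp (- x * c p) \<partial>lborel)"
      by (rule LIMSEQ_offset)
  qed
qed

text \<open>
  Powers are dominated by exponentials of arbitrarily small rate. This separates the behaviour of
  \<open>(p (p + 1))\<^sup>a\<close> at the origin, which is that of \<open>p\<^sup>a\<close>, from its growth at infinity.
\<close>
lemma powr_le_exp:
  fixes a \<delta> :: real
  assumes "\<delta> > 0"
  obtains K where "K \<ge> 0" "\<And>p. p \<ge> 0 \<Longrightarrow> (p + 1) powr a \<le> K * exp (\<delta> * p)"
proof (cases "a \<le> 0")
  case True
  have "(p + 1) powr a \<le> 1 * exp (\<delta> * p)" if "p \<ge> 0" for p
  proof -
    have "(p + 1) powr a \<le> 1 powr a" using that True by (intro powr_mono2') auto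
    also have "\<dots> \<le> exp (\<delta> * p)" using that assms by simp
    finally show ?thesis by simp
  qed
  then show ?thesis using that[of 1] by simp
next
  case False
  then have a: "a > 0" by simp
  \<comment> \<open>\<open>p + 1 \<le> k exp (e p)\<close>, and the power \<open>a\<close> turns the rate \<open>e\<close> into \<open>\<delta>\<close>\<close>
  define e where "e = \<delta> / a"
  define k where "k = max 1 (1 / e)"
  have e: "e > 0" using assms a by (simp add: e_def)
  have k: "k \<ge> 1" "k * e \<ge> 1" using e by (auto simp: k_def max_def field_simps)
  have "(p + 1) powr a \<le> k powr a * exp (\<delta> * p)" if "p \<ge> 0" for p
  proof -
    have "p + 1 \<le> k * (1 + e * p)"
      using k mult_right_mono[OF k(2) that] by (simp add: algebra_simps)
    also have "\<dots> \<le> k * exp (e * p)" using k by (intro mult_left_mono exp_ge_add_one_self) auto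
    finally have "(p + 1) powr a \<le> (k * exp (e * p)) powr a" using a that by (intro powr_mono2) auto
    also have "\<dots> = k powr a * exp (\<delta> * p)" using a by (simp add: powr_mult exp_powr_real e_def)
    finally show ?thesis .
  qed
  then show ?thesis using that[of "k powr a"] by simp
qed

lemma has_bochner_integral_Gamma:
  fixes g x :: real
  assumes "g > 0" "x > 0"
  shows "has_bochner_integral lborel (\<lambda>p. indicator {0<..} p * (p powr (g - 1) * exp (- x * p))) (Gamma g / x powr g)"
proof -
  let ?f = "\<lambda>p::real. indicator {0<..} p * (p powr (g - 1) * exp (- p))"
  have "?f p = indicator {0..} p * p powr (g - 1) / exp p" for p
    by (cases "p = 0") (auto simp: indicator_def exp_minus divide_simps)
  then have "has_bochner_integral lborel ?f (Gamma g)"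
    using Gamma_real_pos[OF assms(1)] Gamma_conv_nn_integral_real[OF assms(1)]
    by (intro has_bochner_integral_nn_integral) auto
  then have f: "integrable lborel ?f" "(\<integral>p. ?f p \<partial>lborel) = Gamma g" by (auto simp: has_bochner_integral_iff)
  have eq: "?f (0 + x * p) = x powr (g - 1) * (indicator {0<..} p * (p powr (g - 1) * exp (- x * p)))" for p
    using assms by (auto simp: indicator_def powr_mult zero_less_mult_iff)
  have "integrable lborel (\<lambda>p. x powr (g - 1) * (indicator {0<..} p * (p powr (g - 1) * exp (- x * p))))"
    using lborel_integrable_real_affine[OF f(1), of x 0] assms unfolding eq by simp
  then have "integrable lborel (\<lambda>p. indicator {0<..} p * (p powr (g - 1) * exp (- x * p)))"
    using assms by simp
  moreover have "Gamma g = x * (x powr (g - 1) * (\<integral>p. indicator {0<..} p * (p powr (g - 1) * exp (- x * p)) \<partial>lborel))"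
    using lborel_integral_real_affine[of x ?f 0] assms f(2) unfolding eq by simp
  then have "Gamma g = x powr g * (\<integral>p. indicator {0<..} p * (p powr (g - 1) * exp (- x * p)) \<partial>lborel)"
    using assms powr_mult_base[of x "g - 1"] by (simp add: mult.assoc[symmetric])
  ultimately show ?thesis using assms by (simp add: has_bochner_integral_iff field_simps)
qed

definition bessel_kernel :: "real \<Rightarrow> real \<Rightarrow> real" where
  "bessel_kernel g p = indicator {0<..} p * (p * (p + 1)) powr (g - 1)"

text \<open>
  This is \<open>2\<^sup>1\<^sup>-\<^sup>2\<^sup>g \<integral>\<^sub>1\<^sup>\<infinity> e\<^sup>-\<^sup>x\<^sup>\<tau> (\<tau>\<^sup>2 - 1)\<^sup>g\<^sup>-\<^sup>1 d\<tau>\<close>, the integral in the classical formula for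
  \<open>K\<^sub>\<nu>\<close> with \<open>\<nu> = g - 1/2\<close>, after the substitution \<open>\<tau> = 2 p + 1\<close>.
\<close>
definition bessel_integral :: "real \<Rightarrow> real \<Rightarrow> real" where
  "bessel_integral g x = (\<integral>p. bessel_kernel g p * exp (- x * (2 * p + 1)) \<partial>lborel)"

lemma bessel_kernel_measurable [measurable]: "bessel_kernel g \<in> borel_measurable borel"
  unfolding bessel_kernel_def by measurable

lemma bessel_kernel_nonneg: "bessel_kernel g p \<ge> 0"
  by (simp add: bessel_kernel_def)

lemma bessel_kernel_integrable:
  assumes g: "g > 0" and x: "x > 0"
  shows "integrable lborel (\<lambda>p. bessel_kernel g p * exp (- x * (2 * p + 1)))"
proof -
  obtain K where K: "K \<ge> 0" "\<And>p. p \<ge> 0 \<Longrightarrow> (p + 1) powr (g - 1) \<le> K * exp (x * p)"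
    using powr_le_exp[OF x] by blast
  show ?thesis
  proof (rule Bochner_Integration.integrable_bound)
    show "integrable lborel (\<lambda>p. K * (indicator {0<..} p * (p powr (g - 1) * exp (- x * p))))"
      using has_bochner_integral_Gamma[OF g x] by (auto simp: has_bochner_integral_iff)
    have "\<bar>bessel_kernel g p * exp (- x * (2 * p + 1))\<bar> \<le> \<bar>K * (indicator {0<..} p * (p powr (g - 1) * exp (- x * p)))\<bar>" for p
    proof (cases "p > 0")
      case True
      have "(p + 1) powr (g - 1) * exp (- x * (2 * p + 1)) \<le> (K * exp (x * p)) * exp (- x * (2 * p))"
        using K True x by (intro mult_mono) auto
      also have "\<dots> = K * exp (- x * p)" by (simp add: mult.assoc exp_add[symmetric])
      finally have "p powr (g - 1) * ((p + 1) powr (g - 1) * exp (- x * (2 * p + 1))) \<le> p powr (g - 1) * (K * exp (- x * p))"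
        by (intro mult_left_mono) auto
      then show ?thesis using True K by (simp add: bessel_kernel_def powr_mult mult_ac)
    qed (simp add: bessel_kernel_def)
    then show "AE p in lborel. norm (bessel_kernel g p * exp (- x * (2 * p + 1))) \<le> norm (K * (indicator {0<..} p * (p powr (g - 1) * exp (- x * p))))"
      by simp
  qed simp
qed

lemma bessel_integral_pos:
  assumes "g > 0" "x > 0"
  shows "bessel_integral g x > 0"
proof -
  have "bessel_integral g x \<ge> 0"
    unfolding bessel_integral_def by (intro Bochner_Integration.integral_nonneg) (simp add: bessel_kernel_nonneg)
  moreover have "bessel_integral g x \<noteq> 0"
  proof
    assume "bessel_integral g x = 0"
    then have "AE p in lborel. bessel_kernel g p * exp (- x * (2 * p + 1)) = 0"
      using integral_nonneg_eq_0_iff_AE[OF bessel_kernel_integrable[OF assms]]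
      by (simp add: bessel_integral_def bessel_kernel_nonneg)
    then have "AE p in lborel. p \<notin> {0<..<1::real}"
      by eventually_elim (auto simp: bessel_kernel_def indicator_def split: if_splits)
    then have "{0<..<1::real} \<in> null_sets lborel" by (subst AE_iff_null_sets) auto
    then have "emeasure lborel {0<..<1::real} = 0" by (rule null_setsD1)
    moreover have "emeasure lborel {0<..<1::real} = 1" by (subst emeasure_lborel_Ioo) auto
    ultimately show False by (metis one_neq_zero)
  qed
  ultimately show ?thesis by simp
qed

text \<open>
  If \<open>J = bessel_integral g\<close>, then \<open>J'' - J\<close> and \<open>J'\<close> are the integrals of
  \<open>4 (p (p + 1))\<^sup>g e\<^sup>-\<^sup>x\<^sup>(\<^sup>2\<^sup>p\<^sup>+\<^sup>1\<^sup>)\<close> and of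
  \<open>- (2 p + 1) (p (p + 1))\<^sup>g\<^sup>-\<^sup>1 e\<^sup>-\<^sup>x\<^sup>(\<^sup>2\<^sup>p\<^sup>+\<^sup>1\<^sup>)\<close>. The derivative of
  \<open>F(p) = (p (p + 1))\<^sup>g e\<^sup>-\<^sup>x\<^sup>(\<^sup>2\<^sup>p\<^sup>+\<^sup>1\<^sup>)\<close> is a combination of the two integrands, and its integral
  vanishes because \<open>F\<close> tends to 0 at both ends.
\<close>
lemma bessel_integral_ode:
  assumes g: "g > 0"
  shows "\<exists>J' J''. \<forall>x>0. (bessel_integral g has_real_derivative J' x) (at x) \<and>
    (J' has_real_derivative J'' x) (at x) \<and> x * J'' x + 2 * g * J' x - x * bessel_integral g x = 0"
proof -
  define c where "c p = 2 * p + 1" for p :: real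
  define k where "k = bessel_kernel g"
  have [measurable]: "c \<in> borel_measurable borel" "k \<in> borel_measurable borel" by (simp_all add: c_def[abs_def] k_def)
  have pos: "c p \<ge> 0" if "k p \<noteq> 0" for p
    using that by (auto simp: k_def c_def bessel_kernel_def indicator_def split: if_splits)
  have int: "integrable lborel (\<lambda>p. k p * exp (- x * c p))" if "x > 0" for x
    using bessel_kernel_integrable[OF g that] by (simp add: k_def c_def)
  define J1 where "J1 x = (\<integral>p. (c p * k p) * exp (- x * c p) \<partial>lborel)" for x
  define J2 where "J2 x = (\<integral>p. (c p * (c p * k p)) * exp (- x * c p) \<partial>lborel)" for x
  have pos1: "c p \<ge> 0" if "c p * k p \<noteq> 0" for p using pos that by simp
  have int1: "integrable lborel (\<lambda>p. (c p * k p) * exp (- x * c p))" if "x > 0" for x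
    by (rule laplace_derivative(1)[of k c, OF _ _ pos int that]) simp_all
  have int2: "integrable lborel (\<lambda>p. (c p * (c p * k p)) * exp (- x * c p))" if "x > 0" for x
    by (rule laplace_derivative(1)[of "\<lambda>p. c p * k p" c, OF _ _ pos1 int1 that]) simp_all
  have J: "bessel_integral g x = (\<integral>p. k p * exp (- x * c p) \<partial>lborel)" for x
    by (simp add: bessel_integral_def k_def c_def)
  have d1: "(bessel_integral g has_real_derivative - J1 x) (at x)" if "x > 0" for x
    unfolding J[abs_def] J1_def by (rule laplace_derivative(2)[of k c, OF _ _ pos int that]) simp_all
  have d2: "((\<lambda>x. - J1 x) has_real_derivative J2 x) (at x)" if "x > 0" for x
  proof -
    have "(J1 has_real_derivative - J2 x) (at x)"
      unfolding J1_def[abs_def] J2_def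
      by (rule laplace_derivative(2)[of "\<lambda>p. c p * k p" c, OF _ _ pos1 int1 that]) simp_all
    from DERIV_minus[OF this] show ?thesis by simp
  qed
  have d3: "x * J2 x + 2 * g * (- J1 x) - x * bessel_integral g x = 0" if x: "x > 0" for x
  proof -
    note i0 = int[OF x] and i1 = int1[OF x] and i2 = int2[OF x]
    define F where "F p = (p * (p + 1)) powr g * exp (- x * c p)" for p
    define f where "f p = g * c p * (p * (p + 1)) powr (g - 1) * exp (- x * c p) - 2 * x * ((p * (p + 1)) powr g * exp (- x * c p))" for p
    \<comment> \<open>\<open>f\<close> is the derivative of \<open>F\<close>; the identity \<open>4 p (p + 1) = c\<^sup>2 - 1\<close> brings in the second derivative\<close>
    have f_eq: "indicator {0<..} p *\<^sub>R f p = g * ((c p * k p) * exp (- x * c p))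
        - (x / 2) * ((c p * (c p * k p)) * exp (- x * c p) - k p * exp (- x * c p))" for p
    proof (cases "p > 0")
      case True
      have "(p * (p + 1)) powr g = (p * (p + 1)) * (p * (p + 1)) powr (g - 1)"
        using powr_mult_base[of "p * (p + 1)" "g - 1"] True by simp
      then have "2 * x * (p * (p + 1)) powr g = (x / 2) * ((4 * (p * (p + 1))) * (p * (p + 1)) powr (g - 1))"
        by simp
      also have "4 * (p * (p + 1)) = c p * c p - 1" by (simp add: c_def algebra_simps)
      finally have m: "2 * x * (p * (p + 1)) powr g = (x / 2) * ((c p * c p - 1) * (p * (p + 1)) powr (g - 1))" .
      have "f p = g * c p * (p * (p + 1)) powr (g - 1) * exp (- x * c p) - (2 * x * (p * (p + 1)) powr g) * exp (- x * c p)"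
        by (simp add: f_def)
      also have "\<dots> = g * (c p * k p * exp (- x * c p)) - (x / 2) * ((c p * (c p * k p)) * exp (- x * c p) - k p * exp (- x * c p))"
        using True unfolding m by (simp add: k_def bessel_kernel_def left_diff_distrib right_diff_distrib mult.assoc)
      finally show ?thesis using True by simp
    qed (simp add: k_def bessel_kernel_def)
    have e: "einterval 0 \<infinity> = {0<..}" by (auto simp: einterval_def zero_ereal_def)
    have "(LBINT p=0..\<infinity>. f p) = 0 - 0"
    proof (rule interval_integral_FTC_integrable)
      show "(F has_vector_derivative f p) (at p)" if "0 < ereal p" for p
      proof -
        have "p > 0" using that by simp
        then have q: "p * (p + 1) > 0" by simp
        have "((\<lambda>p. p * (p + 1)) has_real_derivative c p) (at p)"
          unfolding c_def by (auto intro!: derivative_eq_intros)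
        note P = DERIV_fun_powr[OF this q, of g]
        have "((\<lambda>p. exp (- x * c p)) has_real_derivative exp (- x * c p) * (- x * 2)) (at p)"
          unfolding c_def by (auto intro!: derivative_eq_intros)
        from DERIV_mult[OF P this] have "(F has_real_derivative f p) (at p)"
          unfolding F_def[abs_def] f_def by (rule DERIV_cong) simp
        then show ?thesis by (simp only: has_real_derivative_iff_has_vector_derivative)
      qed
      show "isCont f p" if "0 < ereal p" for p
      proof -
        have "p > 0" using that by simp
        then have "p * (p + 1) \<noteq> 0" by simp
        then show ?thesis unfolding f_def c_def by (intro continuous_intros)
      qed
      show "set_integrable lborel (einterval 0 \<infinity>) f"
        unfolding set_integrable_def e f_eq using i0 i1 i2 by simp
      have "((\<lambda>p::real. p * (p + 1)) \<longlongrightarrow> 0 * (0 + 1)) (at_right 0)" by (intro tendsto_intros)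
      moreover have "\<forall>\<^sub>F p::real in at_right 0. 0 \<le> p * (p + 1)"
        by (auto simp: eventually_at_right_field intro!: exI[of _ 1])
      ultimately have "((\<lambda>p::real. (p * (p + 1)) powr g) \<longlongrightarrow> 0) (at_right 0)"
        using g by (intro tendsto_zero_powrI) auto
      moreover have "((\<lambda>p::real. exp (- x * c p)) \<longlongrightarrow> exp (- x * (2 * 0 + 1))) (at_right 0)"
        unfolding c_def by (intro tendsto_intros)
      ultimately have "(F \<longlongrightarrow> 0 * exp (- x * (2 * 0 + 1))) (at_right 0)"
        unfolding F_def[abs_def] by (rule tendsto_mult)
      then show "((F \<circ> real_of_ereal) \<longlongrightarrow> 0) (at_right 0)"
        unfolding zero_ereal_def ereal_tendsto_simps by simp
      obtain K where K: "K \<ge> 0" "\<And>p. p \<ge> 0 \<Longrightarrow> (p + 1) powr (2 * g) \<le> K * exp (x * p)"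
        using powr_le_exp[OF x] by blast
      have "\<forall>\<^sub>F p in at_top. norm (F p) \<le> K * exp (- x * p)"
        using eventually_ge_at_top[of 0]
      proof eventually_elim
        case (elim p)
        have "(p * (p + 1)) powr g \<le> ((p + 1) * (p + 1)) powr g"
          using elim g by (intro powr_mono2 mult_right_mono) auto
        also have "\<dots> = (p + 1) powr (2 * g)" by (simp add: powr_mult powr_add[symmetric])
        also have "\<dots> \<le> K * exp (x * p)" using K elim by simp
        finally have "(p * (p + 1)) powr g * exp (- x * c p) \<le> (K * exp (x * p)) * exp (- x * (2 * p))"
          using x K elim by (intro mult_mono) (auto simp: c_def)
        also have "\<dots> = K * exp (- x * p)" by (simp add: mult.assoc exp_add[symmetric])
        finally show ?case by (simp add: F_def)
      qed
      moreover have "((\<lambda>p. K * exp (- x * p)) \<longlongrightarrow> K * 0) at_top"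
      proof (intro tendsto_intros filterlim_compose[OF exp_at_bot])
        show "LIM p at_top. - x * p :> at_bot"
          by (rule filterlim_tendsto_neg_mult_at_bot[OF tendsto_const _ filterlim_ident]) (use x in simp)
      qed
      then have "((\<lambda>p. K * exp (- x * p)) \<longlongrightarrow> 0) at_top" by simp
      ultimately have "(F \<longlongrightarrow> 0) at_top" by (rule Lim_null_comparison)
      then show "((F \<circ> real_of_ereal) \<longlongrightarrow> 0) (at_left \<infinity>)"
        unfolding ereal_tendsto_simps .
    qed simp
    then have "(\<integral>p. indicator {0<..} p *\<^sub>R f p \<partial>lborel) = 0"
      by (simp add: interval_lebesgue_integral_def set_lebesgue_integral_def e)
    then have "g * J1 x - (x / 2) * (J2 x - bessel_integral g x) = 0"
      unfolding f_eq J J1_def J2_def using i0 i1 i2 by simp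
    then show ?thesis by (simp add: algebra_simps)
  qed
  show ?thesis
    by (rule exI[of _ "\<lambda>x. - J1 x"], rule exI[of _ J2], intro allI impI conjI) (fact d1 d2 d3)+
qed

text \<open>
  The substitution \<open>p = u / x\<close> gives the integrand
  \<open>u\<^sup>g\<^sup>-\<^sup>1 (1 + u / x)\<^sup>g\<^sup>-\<^sup>1 e\<^sup>-\<^sup>2\<^sup>u\<close>, and \<open>(1 + u / x)\<^sup>g\<^sup>-\<^sup>1 \<le> e\<^sup>u\<close> as soon as \<open>x \<ge> |g - 1|\<close>.
\<close>
lemma bessel_integral_asymptotics:
  assumes g: "g > 0"
  shows "((\<lambda>x. x powr g * exp x * bessel_integral g x) \<longlongrightarrow> Gamma g / 2 powr g) at_top"
proof -
  define s where "s x u = indicator {0<..} u * (u powr (g - 1) * (1 + u / x) powr (g - 1) * exp (- 2 * u))" for x u :: real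
  define b where "b u = indicator {0<..} u * (u powr (g - 1) * exp (- 1 * u))" for u :: real
  define l where "l u = indicator {0<..} u * (u powr (g - 1) * exp (- 2 * u))" for u :: real
  have b: "integrable lborel b"
    using has_bochner_integral_Gamma[OF g, of 1] by (simp add: b_def[abs_def] has_bochner_integral_iff)
  have l: "(\<integral>u. l u \<partial>lborel) = Gamma g / 2 powr g"
    using has_bochner_integral_Gamma[OF g, of 2] by (simp add: l_def[abs_def] has_bochner_integral_iff)
  have eq: "x powr g * exp x * bessel_integral g x = (\<integral>u. s x u \<partial>lborel)" if x: "x > 0" for x
  proof -
    have "bessel_integral g x = (1 / x) * (\<integral>u. bessel_kernel g (0 + (1 / x) * u) * exp (- x * (2 * (0 + (1 / x) * u) + 1)) \<partial>lborel)"
      unfolding bessel_integral_def using x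
      by (subst lborel_integral_real_affine[of "1 / x" _ 0]) auto
    also have "(\<lambda>u. bessel_kernel g (0 + (1 / x) * u) * exp (- x * (2 * (0 + (1 / x) * u) + 1)))
      = (\<lambda>u. (exp (- x) / x powr (g - 1)) * s x u)"
    proof
      fix u
      have "- x * (2 * (0 + (1 / x) * u) + 1) = - x + - 2 * u" using x by (simp add: field_simps)
      then have e: "exp (- x * (2 * (0 + (1 / x) * u) + 1)) = exp (- x) * exp (- 2 * u)" by (simp only: exp_add)
      have "0 < u / x \<longleftrightarrow> 0 < u" using x by (simp add: zero_less_divide_iff)
      then have "bessel_kernel g (0 + (1 / x) * u) = indicator {0<..} u * ((u powr (g - 1) / x powr (g - 1)) * (1 + u / x) powr (g - 1))"
        by (simp add: bessel_kernel_def indicator_def powr_mult powr_divide add.commute)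
      then show "bessel_kernel g (0 + (1 / x) * u) * exp (- x * (2 * (0 + (1 / x) * u) + 1)) = (exp (- x) / x powr (g - 1)) * s x u"
        unfolding e s_def by simp
    qed
    finally have "bessel_integral g x = (exp (- x) / (x * x powr (g - 1))) * (\<integral>u. s x u \<partial>lborel)" by simp
    moreover have "x * x powr (g - 1) = x powr g" using powr_mult_base[of x "g - 1"] x by simp
    ultimately show ?thesis using x by (simp add: exp_minus)
  qed
  have "((\<lambda>x. \<integral>u. s x u \<partial>lborel) \<longlongrightarrow> (\<integral>u. l u \<partial>lborel)) at_top"
  proof (rule integral_dominated_convergence_at_top[OF _ _ b])
    show "AE u in lborel. ((\<lambda>x. s x u) \<longlongrightarrow> l u) at_top"
    proof (intro AE_I2)
      fix u :: real
      have "((\<lambda>x. u / x) \<longlongrightarrow> 0) at_top" by (intro tendsto_divide_0[OF tendsto_const] filterlim_at_top_imp_at_infinity filterlim_ident)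
      then have P: "((\<lambda>x. (1 + u / x) powr (g - 1)) \<longlongrightarrow> (1 + 0) powr (g - 1)) at_top"
        by (rule tendsto_powr[OF tendsto_add[OF tendsto_const] tendsto_const]) simp
      have "((\<lambda>x. s x u) \<longlongrightarrow> indicator {0<..} u * (u powr (g - 1) * (1 + 0) powr (g - 1) * exp (- 2 * u))) at_top"
        unfolding s_def by (intro tendsto_mult tendsto_const P)
      then show "((\<lambda>x. s x u) \<longlongrightarrow> l u) at_top" by (simp add: l_def)
    qed
    show "\<forall>\<^sub>F x in at_top. AE u in lborel. norm (s x u) \<le> b u"
      using eventually_ge_at_top[of "max 1 \<bar>g - 1\<bar>"]
    proof eventually_elim
      case (elim x)
      have "norm (s x u) \<le> b u" for u
      proof (cases "u > 0")
        case True
        have "(1 + u / x) powr (g - 1) \<le> (1 + u / x) powr \<bar>g - 1\<bar>"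
          using elim True by (intro powr_mono) auto
        also have "\<dots> = exp (\<bar>g - 1\<bar> * ln (1 + u / x))"
          using elim True by (simp add: powr_def add_pos_pos less_imp_neq[THEN not_sym])
        also have "\<dots> \<le> exp (x * (u / x))"
        proof -
          have "\<bar>g - 1\<bar> * ln (1 + u / x) \<le> x * (u / x)"
            using elim True ln_add_one_self_le_self[of "u / x"] by (intro mult_mono) auto
          then show ?thesis by simp
        qed
        also have "\<dots> = exp u" using elim by simp
        finally have "(u powr (g - 1) * exp (- 2 * u)) * (1 + u / x) powr (g - 1) \<le> (u powr (g - 1) * exp (- 2 * u)) * exp u"
          by (intro mult_left_mono) auto
        also have "\<dots> = u powr (g - 1) * exp (- 1 * u)" by (simp add: mult.assoc exp_add[symmetric])
        finally show ?thesis using True by (simp add: s_def b_def mult_ac)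
      qed (simp add: s_def b_def)
      then show ?case by simp
    qed
  qed (simp_all add: l_def s_def)
  then show ?thesis unfolding l
    by (rule Lim_transform_eventually)
      (use eventually_gt_at_top[of 0] in eventually_elim, simp add: eq)
qed

definition bessel_K_formula :: "real \<Rightarrow> real \<Rightarrow> real" where
  "bessel_K_formula g x = sqrt pi / Gamma g * (2 * x) powr (g - 1 / 2) * bessel_integral g x"

lemma bessel_K_formula_pos: "g > 0 \<Longrightarrow> x > 0 \<Longrightarrow> bessel_K_formula g x > 0"
  by (simp add: bessel_K_formula_def bessel_integral_pos Gamma_real_pos)

text \<open>
  For \<open>w = x\<^sup>\<nu> J\<close> the modified Bessel equation reads \<open>x J'' + (2 \<nu> + 1) J' - x J = 0\<close>, and
  \<open>2 \<nu> + 1 = 2 g\<close>.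
\<close>
lemma is_bessel_K_bessel_K_formula:
  assumes g: "g > 0"
  shows "is_bessel_K (g - 1 / 2) (bessel_K_formula g)"
proof -
  define \<nu> where "\<nu> = g - 1 / 2"
  define A where "A = sqrt pi / Gamma g * 2 powr \<nu>"
  obtain J' J'' where J: "\<And>x. x > 0 \<Longrightarrow> (bessel_integral g has_real_derivative J' x) (at x)"
    "\<And>x. x > 0 \<Longrightarrow> (J' has_real_derivative J'' x) (at x)"
    "\<And>x. x > 0 \<Longrightarrow> x * J'' x + 2 * g * J' x - x * bessel_integral g x = 0"
    using bessel_integral_ode[OF g] by blast
  define J where "J = bessel_integral g"
  have w: "bessel_K_formula g = (\<lambda>x. A * (x powr \<nu> * J x))"
    by (rule ext) (simp add: bessel_K_formula_def A_def J_def powr_mult \<nu>_def)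
  define w' where "w' x = A * (\<nu> * x powr (\<nu> - 1) * J x + J' x * x powr \<nu>)" for x
  define w'' where "w'' x = A * ((\<nu> * ((\<nu> - 1) * x powr (\<nu> - 1 - 1)) * J x + J' x * (\<nu> * x powr (\<nu> - 1))) + (J'' x * x powr \<nu> + (\<nu> * x powr (\<nu> - 1)) * J' x))" for x
  have "(bessel_K_formula g has_real_derivative w' x) (at x) \<and> (w' has_real_derivative w'' x) (at x) \<and>
    x\<^sup>2 * w'' x + x * w' x - (x\<^sup>2 + \<nu>\<^sup>2) * bessel_K_formula g x = 0" if x: "x > 0" for x
  proof (intro conjI)
    note J0 = J(1)[OF x, folded J_def] and J1 = J(2)[OF x]
    note P = has_real_derivative_powr[OF x]
    show "(bessel_K_formula g has_real_derivative w' x) (at x)"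
      unfolding w w'_def by (intro DERIV_cmult DERIV_mult' DERIV_cong[OF DERIV_mult[OF P[of \<nu>] J0]]) simp
    show "(w' has_real_derivative w'' x) (at x)"
      unfolding w'_def[abs_def] w''_def
      by (intro DERIV_cmult DERIV_add DERIV_cong[OF DERIV_mult[OF DERIV_cmult[OF P[of "\<nu> - 1"], of \<nu>] J0]]
          DERIV_cong[OF DERIV_mult[OF J1 P[of \<nu>]]]) simp_all
    define X where "X = x powr (\<nu> - 1 - 1)"
    have X1: "x powr (\<nu> - 1) = x * X" using powr_mult_base[of x "\<nu> - 1 - 1"] x by (simp add: X_def)
    have X2: "x powr \<nu> = x * (x * X)" using powr_mult_base[of x "\<nu> - 1"] x by (simp add: X1)
    have "x\<^sup>2 * w'' x + x * w' x - (x\<^sup>2 + \<nu>\<^sup>2) * bessel_K_formula g x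
      = A * X * x * x * x * (x * J'' x + (2 * \<nu> + 1) * J' x - x * J x)"
      unfolding w w'_def w''_def X1 X2 X_def[symmetric] by algebra
    also have "\<dots> = 0" using J(3)[OF x] by (simp add: J_def \<nu>_def)
    finally show "x\<^sup>2 * w'' x + x * w' x - (x\<^sup>2 + \<nu>\<^sup>2) * bessel_K_formula g x = 0" .
  qed
  then have ode: "\<exists>w' w''. \<forall>x>0. (bessel_K_formula g has_real_derivative w' x) (at x) \<and> (w' has_real_derivative w'' x) (at x) \<and>
    x\<^sup>2 * w'' x + x * w' x - (x\<^sup>2 + \<nu>\<^sup>2) * bessel_K_formula g x = 0" by blast
  have "((\<lambda>x. 2 powr g / Gamma g * (x powr g * exp x * bessel_integral g x)) \<longlongrightarrow> 2 powr g / Gamma g * (Gamma g / 2 powr g)) at_top"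
    by (intro tendsto_intros bessel_integral_asymptotics g)
  moreover have "2 powr g / Gamma g * (Gamma g / 2 powr g) = 1" using Gamma_real_pos[OF g] by simp
  ultimately have "((\<lambda>x. 2 powr g / Gamma g * (x powr g * exp x * bessel_integral g x)) \<longlongrightarrow> 1) at_top" by simp
  moreover have "\<forall>\<^sub>F x in at_top. 2 powr g / Gamma g * (x powr g * exp x * bessel_integral g x)
    = bessel_K_formula g x / (sqrt (pi / (2 * x)) * exp (- x))"
    using eventually_gt_at_top[of 0]
  proof eventually_elim
    case (elim x)
    define S where "S = sqrt (2 * x)"
    have S: "S > 0" "sqrt (pi / (2 * x)) = sqrt pi / S" "(2 * x) powr (g - 1 / 2) = 2 powr g * x powr g / S"
      using elim by (simp_all add: S_def real_sqrt_divide powr_diff powr_half_sqrt powr_mult real_sqrt_mult)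
    show ?case
      unfolding bessel_K_formula_def S(2,3) using S(1) by (simp add: exp_minus field_simps)
  qed
  ultimately have "((\<lambda>x. bessel_K_formula g x / (sqrt (pi / (2 * x)) * exp (- x))) \<longlongrightarrow> 1) at_top"
    by (rule Lim_transform_eventually)
  then have "bessel_K_formula g \<sim>[at_top] (\<lambda>x. sqrt (pi / (2 * x)) * exp (- x))"
    by (rule asymp_equivI')
  with ode show ?thesis by (simp add: is_bessel_K_def \<nu>_def)
qed

text \<open>
  By the equation, \<open>x (v' w - v w')\<close> is a constant \<open>c\<close>, so that \<open>v / w\<close> has the derivative
  \<open>c / (x w\<^sup>2)\<close>. Since \<open>x w\<^sup>2\<close> decays like \<open>e\<^sup>-\<^sup>2\<^sup>x\<close>, a nonzero \<open>c\<close> would make this derivative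
  larger than 1 in modulus for all large \<open>x\<close>, whereas \<open>v / w\<close> converges to 1. Hence \<open>c = 0\<close> and \<open>v / w\<close> is constant.
\<close>
lemma is_bessel_K_unique:
  assumes w: "is_bessel_K \<nu> w" and pos: "\<And>x. x > 0 \<Longrightarrow> w x > 0" and v: "is_bessel_K \<nu> v" and x0: "x0 > 0"
  shows "v x0 = w x0"
proof -
  define g where "g x = sqrt (pi / (2 * x)) * exp (- x)" for x :: real
  obtain w' w'' where W: "\<And>x. x > 0 \<Longrightarrow> (w has_real_derivative w' x) (at x)"
    "\<And>x. x > 0 \<Longrightarrow> (w' has_real_derivative w'' x) (at x)"
    "\<And>x. x > 0 \<Longrightarrow> x\<^sup>2 * w'' x + x * w' x - (x\<^sup>2 + \<nu>\<^sup>2) * w x = 0"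
    using w unfolding is_bessel_K_def by blast
  obtain v' v'' where V: "\<And>x. x > 0 \<Longrightarrow> (v has_real_derivative v' x) (at x)"
    "\<And>x. x > 0 \<Longrightarrow> (v' has_real_derivative v'' x) (at x)"
    "\<And>x. x > 0 \<Longrightarrow> x\<^sup>2 * v'' x + x * v' x - (x\<^sup>2 + \<nu>\<^sup>2) * v x = 0"
    using v unfolding is_bessel_K_def by blast
  have wg: "w \<sim>[at_top] g" and vg: "v \<sim>[at_top] g"
    using w v unfolding is_bessel_K_def g_def[abs_def] by blast+
  have g_pos: "g x > 0" if "x > 0" for x using that by (simp add: g_def)
  have "((\<lambda>x. if v x = 0 \<and> w x = 0 then 1 else v x / w x) \<longlongrightarrow> 1) at_top"
    by (rule asymp_equivD[OF asymp_equiv_trans[OF vg asymp_equiv_symI[OF wg]]])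
  then have q_lim: "((\<lambda>x. v x / w x) \<longlongrightarrow> 1) at_top"
    by (rule Lim_transform_eventually) (use eventually_gt_at_top[of 0] in eventually_elim, auto dest: pos)
  have "((\<lambda>x. if w x = 0 \<and> g x = 0 then 1 else w x / g x) \<longlongrightarrow> 1) at_top" by (rule asymp_equivD[OF wg])
  then have wg_lim: "((\<lambda>x. w x / g x) \<longlongrightarrow> 1) at_top"
    by (rule Lim_transform_eventually) (use eventually_gt_at_top[of 0] in eventually_elim, auto dest: pos)
  define N where "N x = x * (v' x * w x - v x * w' x)" for x
  have "(N has_real_derivative 0) (at x)" if x: "x > 0" for x
  proof -
    have "(N has_real_derivative 1 * (v' x * w x - v x * w' x)
        + ((v'' x * w x + w' x * v' x) - (v' x * w' x + w'' x * v x)) * x) (at x)"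
      unfolding N_def[abs_def]
      by (intro DERIV_mult DERIV_diff DERIV_ident V W x)
    moreover have "x * (1 * (v' x * w x - v x * w' x) + ((v'' x * w x + w' x * v' x) - (v' x * w' x + w'' x * v x)) * x)
      = w x * (x\<^sup>2 * v'' x + x * v' x - (x\<^sup>2 + \<nu>\<^sup>2) * v x) - v x * (x\<^sup>2 * w'' x + x * w' x - (x\<^sup>2 + \<nu>\<^sup>2) * w x)"
      by algebra
    then have "x * (1 * (v' x * w x - v x * w' x) + ((v'' x * w x + w' x * v' x) - (v' x * w' x + w'' x * v x)) * x) = 0"
      unfolding V(3)[OF x] W(3)[OF x] by simp
    ultimately show ?thesis using x by simp
  qed
  then have "\<exists>c. \<forall>x\<in>{0<..}. N x = c"
    by (intro has_field_derivative_zero_constant) (auto intro: has_field_derivative_at_within)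
  then obtain c where c: "\<And>x. x > 0 \<Longrightarrow> N x = c" by auto
  have q': "((\<lambda>x. v x / w x) has_real_derivative c / (x * (w x)\<^sup>2)) (at x)" if x: "x > 0" for x
  proof -
    have "w x \<noteq> 0" using pos[OF x] by simp
    from DERIV_divide[OF V(1)[OF x] W(1)[OF x] this] show ?thesis
      by (rule DERIV_cong) (use x in \<open>simp add: c[OF x, symmetric] N_def power2_eq_square\<close>)
  qed
  have "c = 0"
  proof (rule ccontr)
    assume "c \<noteq> 0"
    have "((\<lambda>x. (w x / g x)\<^sup>2 * (pi / 2 * exp (- 2 * x))) \<longlongrightarrow> 1\<^sup>2 * (pi / 2 * 0)) at_top"
    proof (intro tendsto_intros wg_lim filterlim_compose[OF exp_at_bot])
      show "LIM x at_top. - 2 * x :> (at_bot :: real filter)"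
        by (rule filterlim_tendsto_neg_mult_at_bot[OF tendsto_const _ filterlim_ident]) simp
    qed
    then have "((\<lambda>x. (w x / g x)\<^sup>2 * (pi / 2 * exp (- 2 * x))) \<longlongrightarrow> 0) at_top" by simp
    then have "((\<lambda>x. x * (w x)\<^sup>2) \<longlongrightarrow> 0) at_top"
    proof (rule Lim_transform_eventually)
      show "\<forall>\<^sub>F x in at_top. (w x / g x)\<^sup>2 * (pi / 2 * exp (- 2 * x)) = x * (w x)\<^sup>2"
        using eventually_gt_at_top[of 0]
      proof eventually_elim
        case (elim x)
        have "x * (g x)\<^sup>2 = pi / 2 * exp (- 2 * x)"
          unfolding g_def power_mult_distrib using elim exp_double[of "- x"] by simp
        then have "(w x / g x)\<^sup>2 * (pi / 2 * exp (- 2 * x)) = (w x / g x)\<^sup>2 * (x * (g x)\<^sup>2)" by simp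
        also have "\<dots> = x * (w x)\<^sup>2" using g_pos[OF elim] by (simp add: power_divide)
        finally show ?case .
      qed
    qed
    then have "\<forall>\<^sub>F x in at_top. x * (w x)\<^sup>2 < \<bar>c\<bar>" using \<open>c \<noteq> 0\<close> by (intro order_tendstoD(2)) auto
    then obtain a where a: "\<And>x. x \<ge> a \<Longrightarrow> x * (w x)\<^sup>2 < \<bar>c\<bar>" by (auto simp: eventually_at_top_linorder)
    define q where "q x = v x / w x" for x
    \<comment> \<open>contradicts the convergence of \<open>q\<close>\<close>
    have "\<bar>q (x + 1) - q x\<bar> \<ge> 1" if "x \<ge> max a 1" for x
    proof -
      have "\<exists>z. x < z \<and> z < x + 1 \<and> q (x + 1) - q x = (x + 1 - x) * (c / (z * (w z)\<^sup>2))"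
        unfolding q_def using that by (intro MVT2) (auto intro!: q')
      then obtain z where z: "x < z" "q (x + 1) - q x = c / (z * (w z)\<^sup>2)" by auto
      have "z > 0" using z that by simp
      then have "z * (w z)\<^sup>2 > 0" using pos[of z] by simp
      moreover have "z * (w z)\<^sup>2 < \<bar>c\<bar>" using a[of z] z that by simp
      ultimately show ?thesis unfolding z(2) by (simp add: abs_divide le_divide_eq)
    qed
    then have "\<forall>\<^sub>F x in at_top. 1 \<le> \<bar>q (x + 1) - q x\<bar>" by (intro eventually_at_top_linorderI[of "max a 1"])
    moreover have "LIM x at_top. 1 + x :> (at_top :: real filter)"
      by (rule filterlim_tendsto_add_at_top[OF tendsto_const filterlim_ident])
    then have shift: "LIM x at_top. x + 1 :> (at_top :: real filter)" by (simp only: add.commute)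
    have "((\<lambda>x. q (x + 1) - q x) \<longlongrightarrow> 1 - 1) at_top"
      unfolding q_def by (rule tendsto_diff[OF filterlim_compose[OF q_lim shift] q_lim])
    then have "((\<lambda>x. q (x + 1) - q x) \<longlongrightarrow> 0) at_top" by simp
    then have "((\<lambda>x. \<bar>q (x + 1) - q x\<bar>) \<longlongrightarrow> 0) at_top" by (rule tendsto_rabs_zero)
    ultimately have "(1 :: real) \<le> 0"
      by (intro tendsto_lowerbound[of "\<lambda>x. \<bar>q (x + 1) - q x\<bar>" 0 at_top]) auto
    then show False by simp
  qed
  then have "((\<lambda>x. v x / w x) has_real_derivative 0) (at x)" if "x > 0" for x using q'[OF that] by simp
  then have "\<exists>k. \<forall>x\<in>{0<..}. v x / w x = k"
    by (intro has_field_derivative_zero_constant) (auto intro: has_field_derivative_at_within)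
  then obtain k where k: "\<And>x. x > 0 \<Longrightarrow> v x / w x = k" by auto
  have "((\<lambda>x :: real. k) \<longlongrightarrow> 1) at_top"
  proof (rule Lim_transform_eventually[OF q_lim])
    show "\<forall>\<^sub>F x in at_top. v x / w x = k"
      using eventually_gt_at_top[of 0] by eventually_elim (rule k)
  qed
  then have "k = 1" by (rule tendsto_unique[OF trivial_limit_at_top_linorder tendsto_const])
  then show ?thesis using k[OF x0] pos[OF x0] by simp
qed

lemma bessel_K_eq_formula:
  assumes "g > 0" "x > 0"
  shows "bessel_K (g - 1 / 2) x = bessel_K_formula g x"
  unfolding bessel_K_def
proof (rule the_equality)
  show "\<exists>w. is_bessel_K (g - 1 / 2) w \<and> w x = bessel_K_formula g x"
    using is_bessel_K_bessel_K_formula[OF assms(1)] by blast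
  fix y assume "\<exists>w. is_bessel_K (g - 1 / 2) w \<and> w x = y"
  then show "y = bessel_K_formula g x"
    using is_bessel_K_unique[OF is_bessel_K_bessel_K_formula[OF assms(1)] bessel_K_formula_pos[OF assms(1)] _ assms(2)] by blast
qed

section \<open>The covariance of the mild solution\<close>

text \<open>The factor \<open>1 / \<Gamma>(\<gamma>)\<close> of the mild solution is left to the covariance.\<close>
definition temporal_kernel :: "real \<Rightarrow> real \<Rightarrow> real \<Rightarrow> real \<Rightarrow> real" where
  "temporal_kernel \<kappa> \<gamma> t r = indicator {0..t} r * ((t - r) powr (\<gamma> - 1) * exp (- \<kappa> * (t - r)))"

definition temporal_covariance :: "real \<Rightarrow> real \<Rightarrow> real \<Rightarrow> real \<Rightarrow> real" where
  "temporal_covariance \<kappa> \<gamma> s t =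
     (1 / (Gamma \<gamma>)\<^sup>2) * (\<integral>r. temporal_kernel \<kappa> \<gamma> s r * temporal_kernel \<kappa> \<gamma> t r \<partial>lborel)"

lemma temporal_covariance_commute: "temporal_covariance \<kappa> \<gamma> s t = temporal_covariance \<kappa> \<gamma> t s"
  by (simp add: temporal_covariance_def mult.commute)

text \<open>
  The substitution \<open>r = t - h p\<close> makes \<open>t - r = h p\<close> and \<open>t + h - r = h (p + 1)\<close>, so that the
  dependence on \<open>t\<close> is confined to the range of integration.
\<close>
lemma temporal_kernel_product:
  assumes h: "h > 0"
  shows "temporal_kernel \<kappa> \<gamma> t (t + - h * p) * temporal_kernel \<kappa> \<gamma> (t + h) (t + - h * p)
    = h powr (2 * \<gamma> - 2) * (indicator {..t / h} p * (bessel_kernel \<gamma> p * exp (- (\<kappa> * h) * (2 * p + 1))))"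
proof (cases "0 < p \<and> p \<le> t / h")
  case True
  then have "h * p \<le> t" "h * p \<ge> 0" using h by (auto simp: field_simps)
  then have i: "t + - h * p \<in> {0..t}" "t + - h * p \<in> {0..t + h}" using h by auto
  have 1: "t - (t + - h * p) = h * p" "t + h - (t + - h * p) = h * (p + 1)" by (simp_all add: algebra_simps)
  have e: "exp (- \<kappa> * (h * p)) * exp (- \<kappa> * (h * (p + 1))) = exp (- (\<kappa> * h) * (2 * p + 1))"
    by (simp add: exp_add[symmetric] algebra_simps)
  have "h powr (\<gamma> - 1) * h powr (\<gamma> - 1) = h powr (2 * \<gamma> - 2)" by (simp add: powr_add[symmetric])
  moreover have "temporal_kernel \<kappa> \<gamma> t (t + - h * p) * temporal_kernel \<kappa> \<gamma> (t + h) (t + - h * p)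
    = (h powr (\<gamma> - 1) * h powr (\<gamma> - 1)) * ((p * (p + 1)) powr (\<gamma> - 1) *
      (exp (- \<kappa> * (h * p)) * exp (- \<kappa> * (h * (p + 1)))))"
    unfolding temporal_kernel_def 1 powr_mult using i by simp
  ultimately show ?thesis using True unfolding e by (simp add: bessel_kernel_def)
next
  case False
  then consider "p < 0" | "p = 0" | "p > t / h" by linarith
  then show ?thesis
  proof cases
    case 1
    then have "h * p < 0" using h by (simp add: mult_pos_neg)
    then show ?thesis using 1 by (simp add: temporal_kernel_def bessel_kernel_def)
  next
    case 2
    then show ?thesis by (simp add: temporal_kernel_def bessel_kernel_def)
  next
    case 3
    then have "h * p > t" using h by (simp add: field_simps)
    then show ?thesis using 3 by (simp add: temporal_kernel_def)
  qed
qed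

lemma temporal_covariance_tendsto:
  assumes \<gamma>: "\<gamma> > 0" and \<kappa>: "\<kappa> > 0" and h: "h > 0"
  shows "((\<lambda>t. temporal_covariance \<kappa> \<gamma> t (t + h)) \<longlongrightarrow>
    h powr (2 * \<gamma> - 1) / (Gamma \<gamma>)\<^sup>2 * bessel_integral \<gamma> (\<kappa> * h)) at_top"
proof -
  define k where "k p = bessel_kernel \<gamma> p * exp (- (\<kappa> * h) * (2 * p + 1))" for p
  have k: "integrable lborel k" unfolding k_def using bessel_kernel_integrable[OF \<gamma>, of "\<kappa> * h"] \<kappa> h by simp
  have [measurable]: "k \<in> borel_measurable borel" unfolding k_def[abs_def] by measurable
  have hh: "h * h powr (2 * \<gamma> - 2) = h powr (2 * \<gamma> - 1)" using powr_mult_base[of h "2 * \<gamma> - 2"] h by simp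
  have eq: "temporal_covariance \<kappa> \<gamma> t (t + h)
    = h powr (2 * \<gamma> - 1) / (Gamma \<gamma>)\<^sup>2 * (\<integral>p. indicator {..t / h} p * k p \<partial>lborel)" for t
  proof -
    have "(\<integral>r. temporal_kernel \<kappa> \<gamma> t r * temporal_kernel \<kappa> \<gamma> (t + h) r \<partial>lborel)
      = h * (\<integral>p. temporal_kernel \<kappa> \<gamma> t (t + - h * p) * temporal_kernel \<kappa> \<gamma> (t + h) (t + - h * p) \<partial>lborel)"
      using lborel_integral_real_affine[of "- h" "\<lambda>r. temporal_kernel \<kappa> \<gamma> t r * temporal_kernel \<kappa> \<gamma> (t + h) r" t] h by simp
    also have "\<dots> = h * (h powr (2 * \<gamma> - 2) * (\<integral>p. indicator {..t / h} p * k p \<partial>lborel))"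
      unfolding temporal_kernel_product[OF h] k_def[symmetric] by simp
    also have "\<dots> = h powr (2 * \<gamma> - 1) * (\<integral>p. indicator {..t / h} p * k p \<partial>lborel)"
      by (simp add: hh[symmetric] mult.assoc)
    finally show ?thesis by (simp add: temporal_covariance_def)
  qed
  have "((\<lambda>t. \<integral>p. indicator {..t / h} p * k p \<partial>lborel) \<longlongrightarrow> (\<integral>p. k p \<partial>lborel)) at_top"
  proof (rule integral_dominated_convergence_at_top)
    show "integrable lborel (\<lambda>p. \<bar>k p\<bar>)" using k by simp
    show "\<forall>\<^sub>F t in at_top. AE p in lborel. norm (indicator {..t / h} p * k p) \<le> \<bar>k p\<bar>"
      by (intro always_eventually allI AE_I2) (simp add: indicator_def)
    show "AE p in lborel. ((\<lambda>t. indicator {..t / h} p * k p) \<longlongrightarrow> k p) at_top"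
    proof (intro AE_I2 tendsto_eventually)
      fix p
      show "\<forall>\<^sub>F t in at_top. indicator {..t / h} p * k p = k p"
        using eventually_ge_at_top[of "h * p"]
      proof eventually_elim
        case (elim t)
        then have "p \<le> t / h" using h by (simp add: field_simps)
        then show ?case by simp
      qed
    qed
  qed simp_all
  then show ?thesis unfolding eq bessel_integral_def k_def[symmetric] by (intro tendsto_mult tendsto_const)
qed

text \<open>Each time section of a generator of the predictable \<open>\<sigma>\<close>-algebra is empty or an event of the filtration.\<close>
lemma predictable_process_measurable:
  assumes filt: "normal_filtration M F" and Z: "predictable_process M F Z" and t: "0 \<le> t"
  shows "Z t \<in> borel_measurable M"
proof -
  have sub: "A \<in> sets M" "A \<subseteq> space M" if "A \<in> sets (F s)" "0 \<le> s" for A s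
  proof -
    have "subalgebra M (F s)" using filt that(2) by (simp add: normal_filtration_def)
    then show "A \<in> sets M" using that(1) by (auto simp: subalgebra_def)
    then show "A \<subseteq> space M" by (rule sets.sets_into_space)
  qed
  have "(\<lambda>\<omega>. (t, \<omega>)) \<in> measurable M (predictable_algebra M F)"
    unfolding predictable_algebra_def
  proof (rule measurable_measure_of)
    let ?A = "{{s<..u} \<times> A |s u A. 0 \<le> s \<and> s < u \<and> A \<in> sets (F s)} \<union> {{0} \<times> A |A. A \<in> sets (F 0)}"
    show "?A \<subseteq> Pow ({0..} \<times> space M)" using sub(2) by fastforce
    show "(\<lambda>\<omega>. (t, \<omega>)) \<in> space M \<rightarrow> {0..} \<times> space M" using t by auto
    fix X assume "X \<in> ?A"
    then obtain I A where X: "X = I \<times> A" "A \<in> sets M" using sub(1) by blast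
    have "(\<lambda>\<omega>. (t, \<omega>)) -` X \<inter> space M = (if t \<in> I then A else {})"
      using X sets.sets_into_space[OF X(2)] by auto
    then show "(\<lambda>\<omega>. (t, \<omega>)) -` X \<inter> space M \<in> sets M" using X by simp
  qed
  moreover have "(\<lambda>(t, \<omega>). Z t \<omega>) \<in> borel_measurable (predictable_algebra M F)"
    using Z by (simp add: predictable_process_def)
  ultimately have "(\<lambda>\<omega>. (\<lambda>(t, \<omega>). Z t \<omega>) (t, \<omega>)) \<in> borel_measurable M" by (rule measurable_compose)
  then show ?thesis by simp
qed

lemma cov_operator_eqI:
  fixes T :: "'h::{real_inner, banach, second_countable_topology} \<Rightarrow>\<^sub>L 'h"
  assumes "\<And>x y. inner (T x) y
    = (\<integral>\<omega>. inner (X \<omega> - (\<integral>\<omega>'. X \<omega>' \<partial>M)) x * inner (Y \<omega> - (\<integral>\<omega>'. Y \<omega>' \<partial>M)) y \<partial>M)"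
  shows "cov_operator M X Y = T"
  unfolding cov_operator_def
proof (rule the_equality)
  show "\<forall>x y. inner (T x) y
    = (\<integral>\<omega>. inner (X \<omega> - (\<integral>\<omega>'. X \<omega>' \<partial>M)) x * inner (Y \<omega> - (\<integral>\<omega>'. Y \<omega>' \<partial>M)) y \<partial>M)"
    using assms by blast
  fix T' assume T': "\<forall>x y. inner (blinfun_apply T' x) y
    = (\<integral>\<omega>. inner (X \<omega> - (\<integral>\<omega>'. X \<omega>' \<partial>M)) x * inner (Y \<omega> - (\<integral>\<omega>'. Y \<omega>' \<partial>M)) y \<partial>M)"
  have "inner (T' x) y = inner (T x) y" for x y unfolding assms using T' by blast
  then have "inner (T' x - T x) y = 0" for x y by (simp add: inner_diff_left)
  then have "T' x = T x" for x by (metis inner_eq_zero_iff right_minus_eq)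
  then show "T' = T" by (intro blinfun_eqI)
qed

lemma (in Q_Wiener) mild_solution_covariance:
  fixes Z :: "real \<Rightarrow> 'a \<Rightarrow> 'h"
  assumes Z: "mild_solution M F Q W A (\<lambda>t. exp (- \<kappa> * t) *\<^sub>R id_blinfun) \<gamma> Z" and st: "0 \<le> s" "0 \<le> t"
  shows "cov_operator M (Z s) (Z t) = temporal_covariance \<kappa> \<gamma> s t *\<^sub>R Q"
proof -
  have pred: "predictable_process M F Z" using Z unfolding mild_solution_def by (elim conjE)
  have ex: "\<forall>t\<ge>0. \<exists>Y. has_stochastic_integral M Q W t (\<lambda>s. (t - s) powr (\<gamma> - 1) *\<^sub>R exp (- \<kappa> * (t - s)) *\<^sub>R id_blinfun) Y \<and>
      (AE \<omega> in M. Z t \<omega> = (1 / Gamma \<gamma>) *\<^sub>R Y \<omega>)"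
    using Z unfolding mild_solution_def by (elim conjE)
  have rep: "\<exists>Y. has_stochastic_integral M Q W t (\<lambda>s. ((t - s) powr (\<gamma> - 1) * exp (- \<kappa> * (t - s))) *\<^sub>R id_blinfun) Y \<and>
      (AE \<omega> in M. Z t \<omega> = (1 / Gamma \<gamma>) *\<^sub>R Y \<omega>)" if "0 \<le> t" for t
    using ex[rule_format, OF that] unfolding scaleR_scaleR .
  obtain Y where Y: "has_stochastic_integral M Q W s (\<lambda>r. ((s - r) powr (\<gamma> - 1) * exp (- \<kappa> * (s - r))) *\<^sub>R id_blinfun) Y"
    "AE \<omega> in M. Z s \<omega> = (1 / Gamma \<gamma>) *\<^sub>R Y \<omega>" using rep[OF st(1)] by (elim exE conjE)
  obtain Y' where Y': "has_stochastic_integral M Q W t (\<lambda>r. ((t - r) powr (\<gamma> - 1) * exp (- \<kappa> * (t - r))) *\<^sub>R id_blinfun) Y'"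
    "AE \<omega> in M. Z t \<omega> = (1 / Gamma \<gamma>) *\<^sub>R Y' \<omega>" using rep[OF st(2)] by (elim exE conjE)
  note mY = borel_measurable_integrable[OF stochastic_integral_mean(1)[OF Y(1)]]
    and mY' = borel_measurable_integrable[OF stochastic_integral_mean(1)[OF Y'(1)]]
  note mZ = predictable_process_measurable[OF filtration pred st(1)] predictable_process_measurable[OF filtration pred st(2)]
  have "(\<integral>\<omega>. Z s \<omega> \<partial>M) = (\<integral>\<omega>. (1 / Gamma \<gamma>) *\<^sub>R Y \<omega> \<partial>M)"
    by (rule integral_cong_AE[OF mZ(1) _ Y(2)]) (use mY in simp)
  then have m: "(\<integral>\<omega>. Z s \<omega> \<partial>M) = 0" using stochastic_integral_mean(2)[OF Y(1)] by simp
  have "(\<integral>\<omega>. Z t \<omega> \<partial>M) = (\<integral>\<omega>. (1 / Gamma \<gamma>) *\<^sub>R Y' \<omega> \<partial>M)"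
    by (rule integral_cong_AE[OF mZ(2) _ Y'(2)]) (use mY' in simp)
  then have m': "(\<integral>\<omega>. Z t \<omega> \<partial>M) = 0" using stochastic_integral_mean(2)[OF Y'(1)] by simp
  show ?thesis
  proof (rule cov_operator_eqI)
    fix x y
    have "(\<integral>\<omega>. inner (Z s \<omega> - (\<integral>\<omega>'. Z s \<omega>' \<partial>M)) x * inner (Z t \<omega> - (\<integral>\<omega>'. Z t \<omega>' \<partial>M)) y \<partial>M)
      = (\<integral>\<omega>. (1 / (Gamma \<gamma>)\<^sup>2) * (inner (Y \<omega>) x * inner (Y' \<omega>) y) \<partial>M)"
      unfolding m m' diff_zero
    proof (rule integral_cong_AE)
      show "(\<lambda>\<omega>. inner (Z s \<omega>) x * inner (Z t \<omega>) y) \<in> borel_measurable M" using mZ by simp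
      show "(\<lambda>\<omega>. (1 / (Gamma \<gamma>)\<^sup>2) * (inner (Y \<omega>) x * inner (Y' \<omega>) y)) \<in> borel_measurable M" using mY mY' by simp
      show "AE \<omega> in M. inner (Z s \<omega>) x * inner (Z t \<omega>) y = (1 / (Gamma \<gamma>)\<^sup>2) * (inner (Y \<omega>) x * inner (Y' \<omega>) y)"
        using Y(2) Y'(2) by eventually_elim (simp add: power2_eq_square)
    qed
    also have "\<dots> = (1 / (Gamma \<gamma>)\<^sup>2) * ((\<integral>r. temporal_kernel \<kappa> \<gamma> s r * temporal_kernel \<kappa> \<gamma> t r \<partial>lborel) * inner (Q x) y)"
      unfolding temporal_kernel_def stochastic_integral_covariance[OF Y(1) Y'(1), symmetric] by simp
    also have "\<dots> = inner ((temporal_covariance \<kappa> \<gamma> s t *\<^sub>R Q) x) y"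
      by (simp add: temporal_covariance_def scaleR_blinfun.rep_eq)
    finally show "inner ((temporal_covariance \<kappa> \<gamma> s t *\<^sub>R Q) x) y
      = (\<integral>\<omega>. inner (Z s \<omega> - (\<integral>\<omega>'. Z s \<omega>' \<partial>M)) x * inner (Z t \<omega> - (\<integral>\<omega>'. Z t \<omega>' \<partial>M)) y \<partial>M)" by simp
  qed
qed

text \<open>
  The closed form of the Bessel function is inserted and the powers of 2 and \<open>\<kappa>\<close> cancel. For
  \<open>h < 0\<close> the covariance at \<open>(t, t + h)\<close> is, by symmetry, the one at \<open>(t', t' + |h|)\<close> with
  \<open>t' = t - |h|\<close>.
\<close>
lemma temporal_covariance_tendsto_Matern:
  assumes \<gamma>: "\<gamma> > 0" and \<kappa>: "\<kappa> > 0" and h: "h \<noteq> 0"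
  shows "((\<lambda>t. temporal_covariance \<kappa> \<gamma> t (t + h)) \<longlongrightarrow>
    2 powr (1 / 2 - \<gamma>) * \<kappa> powr (1 - 2 * \<gamma>) / (sqrt pi * Gamma \<gamma>) *
    (\<kappa> * \<bar>h\<bar>) powr (\<gamma> - 1 / 2) * bessel_K (\<gamma> - 1 / 2) (\<kappa> * \<bar>h\<bar>)) at_top"
proof -
  define a where "a = \<bar>h\<bar>"
  have a: "a > 0" "\<kappa> * a > 0" using h \<kappa> by (simp_all add: a_def)
  have G: "Gamma \<gamma> > 0" using \<gamma> by (rule Gamma_real_pos)
  have p2: "2 powr (1 / 2 - \<gamma>) * 2 powr (\<gamma> - 1 / 2) = (1 :: real)" by (simp add: powr_add[symmetric])
  have "\<kappa> powr (1 - 2 * \<gamma>) * (\<kappa> powr (\<gamma> - 1 / 2) * \<kappa> powr (\<gamma> - 1 / 2)) = \<kappa> powr ((1 - 2 * \<gamma>) + ((\<gamma> - 1 / 2) + (\<gamma> - 1 / 2)))"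
    unfolding powr_add ..
  then have pk: "\<kappa> powr (1 - 2 * \<gamma>) * (\<kappa> powr (\<gamma> - 1 / 2) * \<kappa> powr (\<gamma> - 1 / 2)) = 1" using \<kappa> by simp
  have ph: "a powr (\<gamma> - 1 / 2) * a powr (\<gamma> - 1 / 2) = a powr (2 * \<gamma> - 1)" by (simp add: powr_add[symmetric])
  have "2 powr (1 / 2 - \<gamma>) * \<kappa> powr (1 - 2 * \<gamma>) / (sqrt pi * Gamma \<gamma>) * (\<kappa> * a) powr (\<gamma> - 1 / 2) * bessel_K (\<gamma> - 1 / 2) (\<kappa> * a)
    = (2 powr (1 / 2 - \<gamma>) * 2 powr (\<gamma> - 1 / 2)) * (\<kappa> powr (1 - 2 * \<gamma>) * (\<kappa> powr (\<gamma> - 1 / 2) * \<kappa> powr (\<gamma> - 1 / 2)))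
      * (a powr (\<gamma> - 1 / 2) * a powr (\<gamma> - 1 / 2)) / (Gamma \<gamma>)\<^sup>2 * bessel_integral \<gamma> (\<kappa> * a)"
    unfolding bessel_K_eq_formula[OF \<gamma> a(2)] bessel_K_formula_def powr_mult using G
    by (simp add: power2_eq_square)
  then have const: "2 powr (1 / 2 - \<gamma>) * \<kappa> powr (1 - 2 * \<gamma>) / (sqrt pi * Gamma \<gamma>) * (\<kappa> * a) powr (\<gamma> - 1 / 2) * bessel_K (\<gamma> - 1 / 2) (\<kappa> * a)
    = a powr (2 * \<gamma> - 1) / (Gamma \<gamma>)\<^sup>2 * bessel_integral \<gamma> (\<kappa> * a)"
    unfolding p2 pk ph by simp
  note lim = temporal_covariance_tendsto[OF \<gamma> \<kappa> a(1), folded const]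
  show ?thesis
  proof (cases "h > 0")
    case True
    then have "a = h" by (simp add: a_def)
    then show ?thesis using lim by (simp add: a_def)
  next
    case False
    then have ah: "h = - a" using h by (simp add: a_def)
    have "LIM t at_top. - a + t :> (at_top :: real filter)"
      by (rule filterlim_tendsto_add_at_top[OF tendsto_const filterlim_ident])
    from filterlim_compose[OF lim this]
    have "((\<lambda>t. temporal_covariance \<kappa> \<gamma> t (- a + t)) \<longlongrightarrow>
      2 powr (1 / 2 - \<gamma>) * \<kappa> powr (1 - 2 * \<gamma>) / (sqrt pi * Gamma \<gamma>) * (\<kappa> * a) powr (\<gamma> - 1 / 2) * bessel_K (\<gamma> - 1 / 2) (\<kappa> * a)) at_top"
      by (simp add: temporal_covariance_commute)
    then show ?thesis unfolding a_def[symmetric] unfolding ah by (simp only: add.commute)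
  qed
qed

theorem corollary4p3:
  fixes M :: "'a measure"
    and F :: "real \<Rightarrow> 'a measure"
    and Q A :: "'h::{real_inner, banach, second_countable_topology} \<Rightarrow>\<^sub>L 'h"
    and S :: "real \<Rightarrow> 'h \<Rightarrow>\<^sub>L 'h"
    and W :: "real \<Rightarrow> 'h \<Rightarrow> 'a \<Rightarrow> real"
    and Z :: "real \<Rightarrow> 'a \<Rightarrow> 'h"
    and \<kappa> \<gamma> :: real
  assumes "prob_space M" and "complete_measure M" and "normal_filtration M F"
    and "self_adjoint Q" and "strictly_positive Q"
    and "cylindrical_Q_Wiener M F Q W"
    and "\<kappa> > 0" and "\<gamma> > 1 / 2"
    and "A = \<kappa> *\<^sub>R id_blinfun"
    and "S = (\<lambda>t. exp (- \<kappa> * t) *\<^sub>R id_blinfun)"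
    and "(\<integral>\<^sup>+t\<in>{0..}. hs_norm_sq (t powr (\<gamma> - 1) *\<^sub>R (S t o\<^sub>L op_sqrt Q)) \<partial>lborel) < \<infinity>"
    and "mild_solution M F Q W A S \<gamma> Z"
  shows "\<exists>\<rho> :: real \<Rightarrow> real \<Rightarrow> real.
     (\<forall>s\<ge>0. \<forall>t\<ge>0. cov_operator M (Z s) (Z t) = \<rho> s t *\<^sub>R Q) \<and>
     (\<forall>h. h \<noteq> 0 \<longrightarrow>
        ((\<lambda>t. \<rho> t (t + h)) \<longlongrightarrow>
           2 powr (1 / 2 - \<gamma>) * \<kappa> powr (1 - 2 * \<gamma>) / (sqrt pi * Gamma \<gamma>) *
           (\<kappa> * \<bar>h\<bar>) powr (\<gamma> - 1 / 2) * bessel_K (\<gamma> - 1 / 2) (\<kappa> * \<bar>h\<bar>)) at_top)"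
proof -
  interpret Q_Wiener M F Q W
    using assms(1,3-6) by (simp add: Q_Wiener_def Q_Wiener_axioms_def)
  have "\<gamma> > 0" using \<open>\<gamma> > 1 / 2\<close> by simp
  have "cov_operator M (Z s) (Z t) = temporal_covariance \<kappa> \<gamma> s t *\<^sub>R Q" if "s \<ge> 0" "t \<ge> 0" for s t
    using mild_solution_covariance[OF assms(12)[unfolded assms(10)] that] .
  with temporal_covariance_tendsto_Matern[OF \<open>\<gamma> > 0\<close> \<open>\<kappa> > 0\<close>] show ?thesis
    by (intro exI[of _ "temporal_covariance \<kappa> \<gamma>"] conjI allI impI)
qed

end
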